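(* Fix an integer $d\ge 3$ and let $I\subset K[x,y,z]$ be the ideal generated by all monomials of degree $d$ which are invariant under the action of $M_{a,b}=\begin{pmatrix}1&0&0\\0&e^a&0\\0&0&e^b\end{pmatrix}$, with $1\le a\le b\le d-1$ and $\gcd(a,b,d)=1$. Then $I$ is a GT-system.
   Context: $K$ is an algebraically closed field of characteristic zero, $R=K[x,y,z]$, and $e\in K$ is a primitive $d$-th root of $1$. The matrix $M_{a,b}$ acts on $R$ by $x\mapsto x$, $y\mapsto e^a y$, $z\mapsto e^b z$; a form is invariant if it is fixed by this action. A homogeneous artinian ideal $I\subset R$ has the Weak Lefschetz Property (WLP) if there is a linear form $L\in (R/I)_1$ such that for all integers $j$ the multiplication map $\times L:(R/I)_j\to(R/I)_{j+1}$ has maximal rank, i.e. is injective or surjective. An artinian ideal $I\subset R$ generated by $r\le d+1$ forms of degree $d$ is a Togliatti system if it fails the WLP in degree $d-1$, i.e. for every linear form $L$ the map $\times L:(R/I)_{d-1}\to(R/I)_d$ does not have maximal rank. A GT-system is a Togliatti system $I\subset R$ generated by forms of degree $d$ whose associated regular map $\varphi_I:\mathbb{P}^2\to\mathbb{P}^{\mu(I)-1}$ (given by a minimal set of generators of $I$, where $\mu(I)$ is the minimal number of generators) is a Galois covering of its image with cyclic Galois group $\mathbb{Z}/d\mathbb{Z}$.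
   Formalization: The case a = b is excluded: there I = (x^d) + (y,z)^d needs d+2 > d+1 generators and multiplication by x is surjective from degree d-1 to d, so I is never a Togliatti system and the claim fails for every such a = b. *)

theory Defs
  imports
    "HOL-Library.Poly_Mapping"
    "HOL-Library.Numeral_Type"
    "HOL-Computational_Algebra.Polynomial"
    "HOL-Algebra.Elementary_Groups"
begin

section \<open>Polynomials, forms and ideals\<close>

type_synonym ('i, 'k) mpoly = "('i \<Rightarrow>\<^sub>0 nat) \<Rightarrow>\<^sub>0 'k"

text \<open>The ring K[x,y,z] is the type of polynomials over the three-element index type 3, with
  x, y, z the variables of index 0, 1, 2.\<close>

type_synonym 'k ternary = "(3, 'k) mpoly"

definition mdeg :: "('i \<Rightarrow>\<^sub>0 nat) \<Rightarrow> nat"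
  where "mdeg m = (\<Sum>i\<in>Poly_Mapping.keys m. Poly_Mapping.lookup m i)"

definition monomial :: "('i \<Rightarrow>\<^sub>0 nat) \<Rightarrow> ('i, 'k::comm_ring_1) mpoly"
  where "monomial m = Poly_Mapping.single m 1"

definition Const :: "'k \<Rightarrow> ('i, 'k::comm_ring_1) mpoly"
  where "Const c = Poly_Mapping.single 0 c"

definition Var :: "'i \<Rightarrow> ('i, 'k::comm_ring_1) mpoly"
  where "Var i = monomial (Poly_Mapping.single i 1)"

text \<open>The value at v, in a K-algebra with structure map c, of a polynomial over K.\<close>

definition eval_via :: "('k \<Rightarrow> 'r) \<Rightarrow> ('i \<Rightarrow> 'r) \<Rightarrow> ('i, 'k::comm_ring_1) mpoly \<Rightarrow> 'r::comm_ring_1"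
  where "eval_via c v f =
    (\<Sum>m\<in>Poly_Mapping.keys f. c (Poly_Mapping.lookup f m) *
        (\<Prod>i\<in>Poly_Mapping.keys m. v i ^ Poly_Mapping.lookup m i))"

definition peval :: "('i \<Rightarrow> 'k) \<Rightarrow> ('i, 'k::comm_ring_1) mpoly \<Rightarrow> 'k"
  where "peval = eval_via (\<lambda>c. c)"

definition psubst :: "('i \<Rightarrow> ('j, 'k) mpoly) \<Rightarrow> ('i, 'k::comm_ring_1) mpoly \<Rightarrow> ('j, 'k) mpoly"
  where "psubst = eval_via Const"

text \<open>The homogeneous component of degree d of the polynomial ring (so 0 is a form of every degree).\<close>

definition forms :: "nat \<Rightarrow> ('i, 'k::comm_ring_1) mpoly set"
  where "forms d = {f. \<forall>m\<in>Poly_Mapping.keys f. mdeg m = d}"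

definition is_ideal :: "'r::comm_ring_1 set \<Rightarrow> bool"
  where "is_ideal = module.subspace (\<lambda>r x. r * x)"

definition ideal_gen :: "'r::comm_ring_1 set \<Rightarrow> 'r set"
  where "ideal_gen = module.span (\<lambda>r x. r * x)"

text \<open>R/I is an artinian ring, expressed by the descending chain condition on the ideals of R
  containing I.\<close>

definition artinian_ideal :: "'r::comm_ring_1 set \<Rightarrow> bool"
  where "artinian_ideal I \<longleftrightarrow> is_ideal I \<and>
    (\<forall>J :: nat \<Rightarrow> 'r set. (\<forall>n. is_ideal (J n) \<and> I \<subseteq> J n \<and> J (Suc n) \<subseteq> J n) \<longrightarrow>
        (\<exists>N. \<forall>n\<ge>N. J n = J N))"

section \<open>Togliatti systems\<close>

definition residue_class :: "'r::comm_ring_1 set \<Rightarrow> 'r \<Rightarrow> 'r set"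
  where "residue_class I f = {f + h |h. h \<in> I}"

text \<open>The graded piece of degree j of R/I.\<close>

definition quot_component :: "('i, 'k::comm_ring_1) mpoly set \<Rightarrow> nat \<Rightarrow> ('i, 'k) mpoly set set"
  where "quot_component I j = residue_class I ` forms j"

text \<open>Multiplication by the class of L on R/I; the residue classes in the union all coincide
  when I is an ideal.\<close>

definition quot_times :: "'r::comm_ring_1 set \<Rightarrow> 'r \<Rightarrow> 'r set \<Rightarrow> 'r set"
  where "quot_times I L C = (\<Union>f\<in>C. residue_class I (L * f))"

definition times_max_rank :: "('i, 'k::comm_ring_1) mpoly set \<Rightarrow> ('i, 'k) mpoly \<Rightarrow> nat \<Rightarrow> bool"
  where "times_max_rank I L j \<longleftrightarrow>
    inj_on (quot_times I L) (quot_component I j) \<or>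
    quot_times I L ` quot_component I j = quot_component I (j + 1)"

definition fails_WLP_in_degree :: "('i, 'k::comm_ring_1) mpoly set \<Rightarrow> nat \<Rightarrow> bool"
  where "fails_WLP_in_degree I j \<longleftrightarrow> (\<forall>L\<in>forms 1. \<not> times_max_rank I L j)"

definition togliatti_system :: "nat \<Rightarrow> 'k::field ternary set \<Rightarrow> bool"
  where "togliatti_system d I \<longleftrightarrow>
    artinian_ideal I \<and>
    (\<exists>S. finite S \<and> card S \<le> d + 1 \<and> S \<subseteq> forms d \<and> I = ideal_gen S) \<and>
    fails_WLP_in_degree I (d - 1)"

section \<open>Projective space and regular maps\<close>

definition proportional :: "('i \<Rightarrow> 'k::field) \<Rightarrow> ('i \<Rightarrow> 'k) \<Rightarrow> bool"
  where "proportional v w \<longleftrightarrow> (\<exists>i. v i \<noteq> 0) \<and> (\<exists>c. c \<noteq> 0 \<and> w = (\<lambda>i. c * v i))"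

quotient_type (overloaded) ('i, 'k) proj = "'i \<Rightarrow> 'k::field" / partial: proportional
proof (rule part_equivpI)
  have "proportional (\<lambda>_::'i. 1::'k) (\<lambda>_. 1)"
    by (auto simp: proportional_def intro: exI[of _ 1])
  then show "\<exists>v :: 'i \<Rightarrow> 'k. proportional v v"
    by blast
  show "symp (proportional :: ('i \<Rightarrow> 'k) \<Rightarrow> _)"
  proof (rule sympI)
    fix v w :: "'i \<Rightarrow> 'k"
    assume "proportional v w"
    then obtain i c where "v i \<noteq> 0" "c \<noteq> 0" "w = (\<lambda>i. c * v i)"
      by (auto simp: proportional_def)
    then show "proportional w v"
      unfolding proportional_def by (auto intro!: exI[of _ i] exI[of _ "inverse c"])
  qed
  show "transp (proportional :: ('i \<Rightarrow> 'k) \<Rightarrow> _)"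
  proof (rule transpI)
    fix u v w :: "'i \<Rightarrow> 'k"
    assume "proportional u v" "proportional v w"
    then obtain i b c where "u i \<noteq> 0" "b \<noteq> 0" "v = (\<lambda>i. b * u i)" "c \<noteq> 0" "w = (\<lambda>i. c * v i)"
      by (auto simp: proportional_def)
    then show "proportional u w"
      unfolding proportional_def by (auto intro!: exI[of _ i] exI[of _ "c * b"])
  qed
qed

type_synonym 'k plane = "(3, 'k) proj"

text \<open>Homogeneous coordinates of a point, and the point with given homogeneous coordinates
  (unspecified at the zero vector).\<close>

abbreviation coords :: "('i, 'k::field) proj \<Rightarrow> 'i \<Rightarrow> 'k"
  where "coords p \<equiv> rep_proj p"

abbreviation point :: "('i \<Rightarrow> 'k) \<Rightarrow> ('i, 'k::field) proj"
  where "point v \<equiv> abs_proj v"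

text \<open>Regularity is local: around every point the map is given by forms of one common degree that
  have no common zero there. The locus where the forms do not all vanish is the open
  neighbourhood. A local representation over a smaller neighbourhood is brought into this shape by
  multiplying all the forms by a form vanishing outside a principal neighbourhood.\<close>

definition regular_map :: "(('i, 'k::field) proj \<Rightarrow> ('j, 'k) proj) \<Rightarrow> bool"
  where "regular_map \<sigma> \<longleftrightarrow>
    (\<forall>p. \<exists>e. \<exists>F :: 'j \<Rightarrow> ('i, 'k) mpoly.
        (\<forall>j. F j \<in> forms e) \<and>
        (\<exists>j. peval (coords p) (F j) \<noteq> 0) \<and>
        (\<forall>q. (\<exists>j. peval (coords q) (F j) \<noteq> 0) \<longrightarrow> \<sigma> q = point (\<lambda>j. peval (coords q) (F j))))"

definition automorphism :: "(('i, 'k::field) proj \<Rightarrow> ('i, 'k) proj) \<Rightarrow> bool"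
  where "automorphism \<sigma> \<longleftrightarrow> bij \<sigma> \<and> regular_map \<sigma> \<and> regular_map (inv_into UNIV \<sigma>)"

text \<open>The map to projective (n-1)-space given by n forms of the same degree. The target is embedded
  in the projective space over index type nat as the subspace where all coordinates of index at
  least n vanish.\<close>

definition induced_map :: "('i, 'k::field) mpoly list \<Rightarrow> ('i, 'k) proj \<Rightarrow> (nat, 'k) proj"
  where "induced_map Fs p = point (\<lambda>j. if j < length Fs then peval (coords p) (Fs ! j) else 0)"

definition no_common_zero :: "('i, 'k::field) mpoly list \<Rightarrow> bool"
  where "no_common_zero Fs \<longleftrightarrow> (\<forall>p. \<exists>F\<in>set Fs. peval (coords p) F \<noteq> 0)"

section \<open>Galois coverings and GT-systems\<close>

text \<open>The coordinate ring of the principal affine open set where the form F of degree d does not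
  vanish: quotients of a form by a power of F of the same degree. Its elements are represented by
  functions on the whole space, of which only the values on that open set matter.\<close>

definition principal_open :: "('i, 'k::field) mpoly \<Rightarrow> ('i, 'k) proj set"
  where "principal_open F = {p. peval (coords p) F \<noteq> 0}"

definition principal_ring :: "nat \<Rightarrow> ('i, 'k::field) mpoly \<Rightarrow> (('i, 'k) proj \<Rightarrow> 'k) set"
  where "principal_ring d F =
    {\<lambda>p. peval (coords p) P / peval (coords p) F ^ k |P k. P \<in> forms (k * d)}"

text \<open>The image of the map induced by Fs meets the i-th standard affine chart in a closed subset,
  whose coordinate ring is generated by the ratios of the j-th coordinate to the i-th one. This is
  its pullback to the principal open set of the i-th form.\<close>

definition image_chart_ring :: "('i, 'k::field) mpoly list \<Rightarrow> nat \<Rightarrow> (('i, 'k) proj \<Rightarrow> 'k) set"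
  where "image_chart_ring Fs i =
    {\<lambda>p. peval (\<lambda>j. if j < length Fs
                    then peval (coords p) (Fs ! j) / peval (coords p) (Fs ! i) else 0) h
      |h :: (nat, 'k) mpoly. True}"

text \<open>Finiteness of the morphism onto its image, on the cover of the image by the standard affine
  charts: the preimage of the i-th chart is the (affine) principal open set of the i-th form, and
  its coordinate ring has to be a finitely generated module over that of the chart.\<close>

definition finite_onto_image :: "nat \<Rightarrow> ('i, 'k::field) mpoly list \<Rightarrow> bool"
  where "finite_onto_image d Fs \<longleftrightarrow>
    (\<forall>i<length Fs. \<exists>G. finite G \<and> G \<subseteq> principal_ring d (Fs ! i) \<and>
      (\<forall>g\<in>principal_ring d (Fs ! i). \<exists>c. (\<forall>h\<in>G. c h \<in> image_chart_ring Fs i) \<and>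
        (\<forall>p\<in>principal_open (Fs ! i). g p = (\<Sum>h\<in>G. c h p * h p))))"

definition deck_transformations :: "(('i, 'k::field) proj \<Rightarrow> 'b) \<Rightarrow> (('i, 'k) proj \<Rightarrow> ('i, 'k) proj) set"
  where "deck_transformations \<phi> = {\<sigma>. automorphism \<sigma> \<and> \<phi> \<circ> \<sigma> = \<phi>}"

definition deck_group :: "(('i, 'k::field) proj \<Rightarrow> 'b) \<Rightarrow> (('i, 'k) proj \<Rightarrow> ('i, 'k) proj) monoid"
  where "deck_group \<phi> = \<lparr>carrier = deck_transformations \<phi>, mult = (\<lambda>\<sigma> \<tau>. \<sigma> \<circ> \<tau>), one = id\<rparr>"

text \<open>The map induced by the forms Fs of degree d is a Galois covering of its image with group
  G: it is a morphism, finite onto its image, whose deck transformation group is isomorphic to G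
  and acts transitively on every fibre.\<close>

definition galois_covering_of_image ::
    "nat \<Rightarrow> ('i, 'k::field) mpoly list \<Rightarrow> ('g, 'h) monoid_scheme \<Rightarrow> bool"
  where "galois_covering_of_image d Fs G \<longleftrightarrow>
    no_common_zero Fs \<and> regular_map (induced_map Fs) \<and>
    finite_onto_image d Fs \<and>
    (\<forall>p q. induced_map Fs p = induced_map Fs q \<longrightarrow>
        (\<exists>\<sigma>\<in>deck_transformations (induced_map Fs). \<sigma> p = q)) \<and>
    deck_group (induced_map Fs) \<cong> G"

definition min_gens_number :: "'r::comm_ring_1 set \<Rightarrow> nat"
  where "min_gens_number I = (LEAST n. \<exists>S. finite S \<and> card S = n \<and> ideal_gen S = I)"

definition minimal_generators :: "nat \<Rightarrow> 'k::field ternary set \<Rightarrow> 'k ternary list \<Rightarrow> bool"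
  where "minimal_generators d I Fs \<longleftrightarrow>
    set Fs \<subseteq> forms d \<and> ideal_gen (set Fs) = I \<and> length Fs = min_gens_number I"

text \<open>Two minimal systems of generators of degree d differ by a linear change of coordinates in the
  target, so the condition does not depend on the choice. It is required for every choice; at least
  one exists, since a Togliatti system is generated by finitely many forms of degree d.\<close>

definition GT_system :: "nat \<Rightarrow> 'k::field ternary set \<Rightarrow> bool"
  where "GT_system d I \<longleftrightarrow>
    togliatti_system d I \<and>
    (\<forall>Fs. minimal_generators d I Fs \<longrightarrow> galois_covering_of_image d Fs (integer_mod_group d))"

section \<open>The diagonal action\<close>

definition primitive_root_of_unity :: "nat \<Rightarrow> 'k::field \<Rightarrow> bool"
  where "primitive_root_of_unity d e \<longleftrightarrow> e ^ d = 1 \<and> (\<forall>k. 0 < k \<and> k < d \<longrightarrow> e ^ k \<noteq> 1)"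

definition M_action :: "'k::field \<Rightarrow> nat \<Rightarrow> nat \<Rightarrow> 'k ternary \<Rightarrow> 'k ternary"
  where "M_action e a b = psubst (\<lambda>i.
    if i = 0 then Var 0
    else if i = 1 then Const (e ^ a) * Var 1
    else Const (e ^ b) * Var 2)"

definition invariant_monomials :: "'k::field \<Rightarrow> nat \<Rightarrow> nat \<Rightarrow> nat \<Rightarrow> 'k ternary set"
  where "invariant_monomials e a b d =
    {monomial m |m. mdeg m = d \<and> M_action e a b (monomial m) = monomial m}"

end

theory Submission
  imports Defs
begin

text \<open>Let S be the set of invariant monomials of degree d.

  Togliatti: the exponents (j, k) of y and z of an invariant monomial satisfy a j + b k = 0 modulo
  d. The solutions modulo d form a cyclic group of order d, and one of them lies outside the
  triangle j + k \<le> d, which leaves at most d + 1 monomials. Given a nonzero linear form L, the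
  product of its conjugates under the cyclic group is a multiple of L of degree d in the span of S,
  which excludes injectivity of the multiplication by L; given the bound on S, counting dimensions
  excludes surjectivity too.

  Galois: the forms of any system of generators of degree d span the same space as S. As S contains the
  powers x^d, y^d, z^d, the map has no base point and is finite. Two points with the same image
  differ, up to a common factor, by d-th roots of unity in the coordinates, and the invariant
  monomials x^(b-a) y^(d-b) z^a and those in two variables force these roots to come from the action.
  Hence the fibres are the orbits, and since the plane is irreducible, a regular map preserving every
  orbit is the action of one fixed element.\<close>

section \<open>Polynomials, forms and ideals\<close>

text \<open>The bound d + 1 on the number of generators is dim R_d - dim R_(d-1). It gives (R/I)_d
  at least the dimension of (R/I)_(d-1), so one nonzero kernel element rules out both kinds of
  maximal rank. The case a = b breaks this bound: then gcd(a, d) = 1, and the invariant monomials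
  are x^d and all d + 1 monomials of degree d in y and z, hence d + 2 independent forms. This is why
  the theorem assumes \<open>a \<noteq> b\<close>. A minimal system of generators need not consist
  of monomials, so ideals are replaced by K-spans in degree d, and values of forms are compared by
  linearity. The delicate points of the plane lie on the coordinate lines: the action need not be
  free there, and a monomial vanishing at a point says nothing about it. Fibres are therefore
  treated according to the support, whereas deck transformations are compared off these lines.
  Algebraic closedness supplies the d-th root that turns proportional values of the invariants into
  equal ones, characteristic zero the points at which a given nonzero polynomial does not
  vanish.\<close>

interpretation ideals: module "(*) :: 'r::comm_ring_1 \<Rightarrow> 'r \<Rightarrow> 'r"
  by unfold_locales (auto simp: algebra_simps)

text \<open>As a simplification rule, this would loop with associativity.\<close>

declare ideals.scale_scale [simp del]

lemma Const_0 [simp]: "Const 0 = 0"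
  by (simp add: Const_def)

lemma Const_1 [simp]: "Const 1 = 1"
  by (simp add: Const_def)

lemma Const_add: "Const (c + c') = Const c + Const c'"
  by (simp add: Const_def single_add)

lemma Const_mult: "Const (c * c') = Const c * Const c'"
  by (simp add: Const_def mult_single)

lemma lookup_Const_mult [simp]:
  "Poly_Mapping.lookup (Const c * f) m = c * Poly_Mapping.lookup f m"
  by (auto simp: Const_def mult_map_scale_conv_mult[symmetric] Poly_Mapping.map.rep_eq when_def)

text \<open>A second structure on the same ring: \<open>ideals\<close> treats R as a module over
  itself, \<open>kspace\<close> as a vector space over K. Dimensions are counted in the
  latter.\<close>

interpretation kspace: vector_space "\<lambda>c (f :: ('i, 'k::field) mpoly). Const c * f"
  unfolding vector_space_def
  by (simp only: Const_add Const_mult Const_1 mult_1_left distrib_left distrib_right mult.assoc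
      simp_thms)

lemma Const_mult_monomial: "Const c * monomial m = Poly_Mapping.single m c"
  by (simp add: Const_def monomial_def mult_single)

lemma monomial_add: "monomial (m + n) = monomial m * monomial n"
  by (simp add: monomial_def mult_single)

lemma keys_monomial [simp]: "Poly_Mapping.keys (monomial m :: ('i, 'k::comm_ring_1) mpoly) = {m}"
  by (simp add: monomial_def)

lemma lookup_monomial: "Poly_Mapping.lookup (monomial m) n = (if m = n then 1 else 0)"
  by (auto simp: monomial_def lookup_single when_def)

lemma poly_mapping_eq_sum_single:
  "(f :: 'a \<Rightarrow>\<^sub>0 'b::comm_monoid_add)
    = (\<Sum>m\<in>Poly_Mapping.keys f. Poly_Mapping.single m (Poly_Mapping.lookup f m))"
proof (rule poly_mapping_eqI)
  fix n
  have "(\<Sum>m\<in>Poly_Mapping.keys f. Poly_Mapping.lookup f m when m = n)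
      = (\<Sum>m\<in>Poly_Mapping.keys f. if n = m then Poly_Mapping.lookup f m else 0)"
    by (rule sum.cong) (auto simp: when_def)
  also have "\<dots> = Poly_Mapping.lookup f n"
    by (auto simp: in_keys_iff)
  finally show "Poly_Mapping.lookup f n = Poly_Mapping.lookup
      (\<Sum>m\<in>Poly_Mapping.keys f. Poly_Mapping.single m (Poly_Mapping.lookup f m)) n"
    by (simp add: lookup_sum lookup_single)
qed

lemma poly_eq_sum_monomials:
  "f = (\<Sum>m\<in>Poly_Mapping.keys f. Const (Poly_Mapping.lookup f m) * monomial m)"
  using poly_mapping_eq_sum_single[of f] by (simp add: Const_mult_monomial)

section \<open>Evaluation at points and substitution of polynomials\<close>

definition monomial_value :: "('i \<Rightarrow> 'r::comm_ring_1) \<Rightarrow> ('i \<Rightarrow>\<^sub>0 nat) \<Rightarrow> 'r"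
  where "monomial_value v m = (\<Prod>i\<in>Poly_Mapping.keys m. v i ^ Poly_Mapping.lookup m i)"

lemma monomial_value_superset:
  assumes "finite A" "Poly_Mapping.keys m \<subseteq> A"
  shows "monomial_value v m = (\<Prod>i\<in>A. v i ^ Poly_Mapping.lookup m i)"
  unfolding monomial_value_def
  by (rule prod.mono_neutral_left) (use assms in \<open>auto simp: in_keys_iff\<close>)

lemma monomial_value_0 [simp]: "monomial_value v 0 = 1"
  by (simp add: monomial_value_def)

lemma monomial_value_single [simp]: "monomial_value v (Poly_Mapping.single i n) = v i ^ n"
  by (simp add: monomial_value_def)

lemma keys_add_nat:
  "Poly_Mapping.keys (m + n) = Poly_Mapping.keys m \<union> Poly_Mapping.keys (n :: 'i \<Rightarrow>\<^sub>0 nat)"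
  by (auto simp: in_keys_iff lookup_add)

lemma monomial_value_add: "monomial_value v (m + n) = monomial_value v m * monomial_value v n"
proof -
  let ?A = "Poly_Mapping.keys m \<union> Poly_Mapping.keys n"
  show ?thesis
    using monomial_value_superset[of ?A m v] monomial_value_superset[of ?A n v]
      monomial_value_superset[of ?A "m + n" v]
    by (simp add: keys_add_nat lookup_add power_add prod.distrib)
qed

lemma monomial_value_scale: "monomial_value (\<lambda>i. c * v i) m = c ^ mdeg m * monomial_value v m"
  by (simp add: monomial_value_def mdeg_def power_mult_distrib prod.distrib power_sum)

lemma eval_via_altdef:
  "eval_via c v f = (\<Sum>m\<in>Poly_Mapping.keys f. c (Poly_Mapping.lookup f m) * monomial_value v m)"
  by (simp add: eval_via_def monomial_value_def)

text \<open>Treats \<open>peval\<close> (identity on coefficients) and \<open>psubst\<close> (the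
  embedding \<open>Const\<close>) at once: both are evaluations along a ring homomorphism of the
  coefficients.\<close>

locale coeff_hom =
  fixes c :: "'k::comm_ring_1 \<Rightarrow> 'r::comm_ring_1"
  assumes hom_0: "c 0 = 0" and hom_1: "c 1 = 1"
    and hom_add: "c (x + y) = c x + c y" and hom_mult: "c (x * y) = c x * c y"
begin

lemma eval_via_superset:
  assumes "finite A" "Poly_Mapping.keys f \<subseteq> A"
  shows "eval_via c v f = (\<Sum>m\<in>A. c (Poly_Mapping.lookup f m) * monomial_value v m)"
  unfolding eval_via_altdef
  by (rule sum.mono_neutral_left) (use assms in \<open>auto simp: in_keys_iff hom_0\<close>)

lemma eval_via_0 [simp]: "eval_via c v 0 = 0"
  by (simp add: eval_via_altdef)

lemma eval_via_single: "eval_via c v (Poly_Mapping.single m x) = c x * monomial_value v m"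
  by (simp add: eval_via_altdef hom_0)

lemma eval_via_Const: "eval_via c v (Const x) = c x"
  by (simp add: Const_def eval_via_single)

lemma eval_via_1: "eval_via c v 1 = 1"
  using eval_via_Const[of v 1] by (simp add: hom_1)

lemma eval_via_monomial: "eval_via c v (monomial m) = monomial_value v m"
  by (simp add: monomial_def eval_via_single hom_1)

lemma eval_via_Var: "eval_via c v (Var i) = v i"
  by (simp add: Var_def eval_via_monomial)

lemma eval_via_add: "eval_via c v (f + g) = eval_via c v f + eval_via c v g"
proof -
  let ?A = "Poly_Mapping.keys f \<union> Poly_Mapping.keys g"
  show ?thesis
    using eval_via_superset[of ?A f v] eval_via_superset[of ?A g v]
      eval_via_superset[of ?A "f + g" v] Poly_Mapping.keys_add[of f g]
    by (simp add: lookup_add hom_add sum.distrib algebra_simps)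
qed

lemma eval_via_sum: "eval_via c v (\<Sum>x\<in>A. f x) = (\<Sum>x\<in>A. eval_via c v (f x))"
  by (induction A rule: infinite_finite_induct) (simp_all add: eval_via_add)

lemma eval_via_mult: "eval_via c v (f * g) = eval_via c v f * eval_via c v g"
proof -
  have "f * g = (\<Sum>m\<in>Poly_Mapping.keys f. Poly_Mapping.single m (Poly_Mapping.lookup f m))
      * (\<Sum>n\<in>Poly_Mapping.keys g. Poly_Mapping.single n (Poly_Mapping.lookup g n))"
    by (simp only: poly_mapping_eq_sum_single[symmetric])
  also have "\<dots> = (\<Sum>m\<in>Poly_Mapping.keys f. \<Sum>n\<in>Poly_Mapping.keys g.
      Poly_Mapping.single (m + n) (Poly_Mapping.lookup f m * Poly_Mapping.lookup g n))"
    by (simp only: sum_product mult_single)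
  finally have "eval_via c v (f * g) = (\<Sum>m\<in>Poly_Mapping.keys f. \<Sum>n\<in>Poly_Mapping.keys g.
      c (Poly_Mapping.lookup f m) * c (Poly_Mapping.lookup g n)
        * (monomial_value v m * monomial_value v n))"
    by (simp only: eval_via_sum eval_via_single hom_mult monomial_value_add)
  also have "\<dots> = eval_via c v f * eval_via c v g"
    by (simp only: eval_via_altdef sum_product mult.assoc mult.left_commute)
  finally show ?thesis .
qed

lemma eval_via_power: "eval_via c v (f ^ n) = eval_via c v f ^ n"
  by (induction n) (simp_all add: eval_via_1 eval_via_mult)

lemma eval_via_prod: "eval_via c v (\<Prod>x\<in>A. f x) = (\<Prod>x\<in>A. eval_via c v (f x))"
  by (induction A rule: infinite_finite_induct) (simp_all add: eval_via_1 eval_via_mult)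

end

interpretation id_hom: coeff_hom "\<lambda>x :: 'k::comm_ring_1. x"
  by unfold_locales auto

interpretation Const_hom: coeff_hom "Const :: 'k::comm_ring_1 \<Rightarrow> ('i, 'k) mpoly"
  by unfold_locales (simp_all add: Const_add Const_mult)

lemmas peval_simps [simp] =
  id_hom.eval_via_0[folded peval_def] id_hom.eval_via_1[folded peval_def]
  id_hom.eval_via_Const[folded peval_def] id_hom.eval_via_Var[folded peval_def]
  id_hom.eval_via_monomial[folded peval_def]
  id_hom.eval_via_add[folded peval_def] id_hom.eval_via_sum[folded peval_def]
  id_hom.eval_via_mult[folded peval_def] id_hom.eval_via_power[folded peval_def]
  id_hom.eval_via_prod[folded peval_def]

lemma peval_altdef:
  "peval v f = (\<Sum>m\<in>Poly_Mapping.keys f. Poly_Mapping.lookup f m * monomial_value v m)"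
  by (simp add: peval_def eval_via_altdef)

lemma peval_uminus [simp]: "peval v (- f) = - peval v f"
  \<comment> \<open>\<open>peval_simps(6)\<close> is additivity, used on f and - f.\<close>
  using peval_simps(6)[of v f "- f"] by (simp add: eq_neg_iff_add_eq_0 add.commute)

lemma peval_diff [simp]: "peval v (f - g) = peval v f - peval v g"
  using peval_simps(6)[of v f "- g"] by simp

section \<open>Degrees and homogeneous forms\<close>

lemma mdeg_superset:
  assumes "finite A" "Poly_Mapping.keys m \<subseteq> A"
  shows "mdeg m = (\<Sum>i\<in>A. Poly_Mapping.lookup m i)"
  unfolding mdeg_def
  by (rule sum.mono_neutral_left) (use assms in \<open>auto simp: in_keys_iff\<close>)

lemma mdeg_add: "mdeg (m + n) = mdeg m + mdeg n"
proof -
  let ?A = "Poly_Mapping.keys m \<union> Poly_Mapping.keys n"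
  show ?thesis
    using mdeg_superset[of ?A m] mdeg_superset[of ?A n] mdeg_superset[of ?A "m + n"]
    by (simp add: keys_add_nat lookup_add sum.distrib)
qed

lemma mdeg_0 [simp]: "mdeg 0 = 0"
  by (simp add: mdeg_def)

lemma mdeg_single [simp]: "mdeg (Poly_Mapping.single i n) = n"
  by (simp add: mdeg_def)

lemma mdeg_eq_0_iff: "mdeg m = 0 \<longleftrightarrow> m = 0"
  by (auto simp: mdeg_def in_keys_iff intro!: poly_mapping_eqI)

lemma forms_0 [simp]: "0 \<in> forms k"
  by (simp add: forms_def)

lemma forms_add: "f \<in> forms k \<Longrightarrow> g \<in> forms k \<Longrightarrow> f + g \<in> forms k"
  using Poly_Mapping.keys_add[of f g] by (auto simp: forms_def)

lemma forms_mult: "f \<in> forms j \<Longrightarrow> g \<in> forms k \<Longrightarrow> f * g \<in> forms (j + k)"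
  using keys_mult[of f g] by (force simp: forms_def mdeg_add)

lemma forms_Const [simp]: "Const c \<in> forms 0"
  by (auto simp: forms_def Const_def)

lemma forms_1 [simp]: "1 \<in> forms 0"
  using forms_Const[of 1] by simp

lemma forms_Const_mult: "f \<in> forms k \<Longrightarrow> Const c * f \<in> forms k"
  using forms_mult[OF forms_Const] by fastforce

lemma forms_monomial [simp]: "monomial m \<in> forms k \<longleftrightarrow> mdeg m = k"
  by (simp add: forms_def)

lemma forms_Var [simp]: "Var i \<in> forms 1"
  by (simp add: Var_def)

lemma forms_prod:
  assumes "\<And>x. x \<in> A \<Longrightarrow> f x \<in> forms (n x)"
  shows "(\<Prod>x\<in>A. f x) \<in> forms (\<Sum>x\<in>A. n x)"
  using assms by (induction A rule: infinite_finite_induct) (auto intro: forms_mult)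

lemma subspace_forms: "kspace.subspace (forms k :: ('i, 'k::field) mpoly set)"
  by (rule kspace.subspaceI) (auto intro: forms_add forms_Const_mult)

lemma forms_diff: "f \<in> forms k \<Longrightarrow> g \<in> forms k \<Longrightarrow> f - g \<in> forms k"
  for f :: "('i, 'k::field) mpoly"
  by (rule kspace.subspace_diff[OF subspace_forms])

lemma peval_forms_scale:
  assumes "f \<in> forms k"
  shows "peval (\<lambda>i. c * v i) f = c ^ k * peval v f"
proof -
  have "Poly_Mapping.lookup f m * monomial_value (\<lambda>i. c * v i) m
      = c ^ k * (Poly_Mapping.lookup f m * monomial_value v m)"
    if "m \<in> Poly_Mapping.keys f" for m
    using that assms by (simp add: forms_def monomial_value_scale mult.left_commute)
  then show ?thesis
    unfolding peval_altdef sum_distrib_left by (rule sum.cong[OF refl])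
qed

lemma inj_monomial: "inj (monomial :: _ \<Rightarrow> ('i, 'k::comm_ring_1) mpoly)"
  by (rule injI) (metis keys_monomial singleton_inject)

text \<open>Comparing coefficients at one exponent isolates a single summand. This supplies the
  lower bound in the later dimension count.\<close>

lemma independent_monomials: "kspace.independent (monomial ` A :: ('i, 'k::field) mpoly set)"
  unfolding kspace.independent_explicit_module
proof (intro allI impI)
  fix t u and v :: "('i, 'k) mpoly"
  assume t: "finite t" "t \<subseteq> monomial ` A" "(\<Sum>f\<in>t. Const (u f) * f) = 0" "v \<in> t"
  obtain B where B: "t = monomial ` B"
    using t(2) by (meson subset_imageE)
  obtain m where m: "m \<in> B" "v = monomial m"
    using t(4) B by blast
  have "finite B"
    using t(1) B inj_on_subset[OF inj_monomial] finite_imageD by blast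
  have "0 = Poly_Mapping.lookup (\<Sum>f\<in>t. Const (u f) * f) m"
    using t(3) by simp
  also have "\<dots> = (\<Sum>n\<in>B. if m = n then u (monomial n) else 0)"
    unfolding B by (subst sum.reindex[OF inj_on_subset[OF inj_monomial]])
      (auto simp: lookup_sum lookup_monomial intro!: sum.cong)
  also have "\<dots> = u v"
    using m \<open>finite B\<close> by simp
  finally show "u v = 0" by simp
qed

text \<open>Up to degree d, the product r t of a form t of degree d with r depends on the constant
  coefficient of r only.\<close>

lemma ideal_gen_forms:
  fixes T :: "('i, 'k::field) mpoly set"
  assumes "T \<subseteq> forms d" "f \<in> ideal_gen T"
  obtains g where "g \<in> kspace.span T"
    "\<And>m. mdeg m \<le> d \<Longrightarrow> Poly_Mapping.lookup f m = Poly_Mapping.lookup g m"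
proof -
  have low: "Poly_Mapping.lookup (r * t) m = Poly_Mapping.lookup (Const (Poly_Mapping.lookup r 0) * t) m"
    if "t \<in> forms d" "mdeg m \<le> d" for r t :: "('i, 'k) mpoly" and m
  proof -
    define r' where "r' = r - Const (Poly_Mapping.lookup r 0)"
    have "0 \<notin> Poly_Mapping.keys r'"
      by (simp add: r'_def in_keys_iff lookup_minus Const_def)
    then have "mdeg n > 0" if "n \<in> Poly_Mapping.keys r'" for n
      using that mdeg_eq_0_iff[of n] by (cases "n = 0") auto
    then have "m \<notin> Poly_Mapping.keys (r' * t)"
      using that keys_mult[of r' t] by (force simp: forms_def mdeg_add)
    then have "Poly_Mapping.lookup (r' * t) m = 0"
      by (simp add: in_keys_iff)
    then show ?thesis
      by (simp only: r'_def left_diff_distrib lookup_minus) simp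
  qed
  have "\<exists>g\<in>kspace.span T. \<forall>m. mdeg m \<le> d \<longrightarrow> Poly_Mapping.lookup f m = Poly_Mapping.lookup g m"
    using assms(2) unfolding ideal_gen_def
  proof (induction rule: ideals.span_induct_alt)
    case base
    then show ?case
      using kspace.span_zero by force
  next
    case (step r t f)
    then obtain g where g: "g \<in> kspace.span T"
      "\<And>m. mdeg m \<le> d \<Longrightarrow> Poly_Mapping.lookup f m = Poly_Mapping.lookup g m"
      by auto
    have "Const (Poly_Mapping.lookup r 0) * t + g \<in> kspace.span T"
      using kspace.span_add[OF kspace.span_scale[OF kspace.span_base[OF step.hyps]] g(1)] .
    moreover have "t \<in> forms d"
      using assms(1) step.hyps by blast
    ultimately show ?case
      using g low by (metis lookup_add)
  qed
  then show ?thesis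
    using that by blast
qed

text \<open>In degree d only constant multiples of the generators contribute: f agrees with an
  element of the span up to degree d, and both are forms of degree d. This is the passage from
  ideals to linear algebra.\<close>

lemma ideal_gen_Int_forms:
  fixes T :: "('i, 'k::field) mpoly set"
  assumes "T \<subseteq> forms d" "f \<in> ideal_gen T" "f \<in> forms d"
  shows "f \<in> kspace.span T"
proof -
  obtain g where g: "g \<in> kspace.span T"
    "\<And>m. mdeg m \<le> d \<Longrightarrow> Poly_Mapping.lookup f m = Poly_Mapping.lookup g m"
    using ideal_gen_forms[OF assms(1,2)] by blast
  have "g \<in> forms d"
    using kspace.span_minimal[OF assms(1) subspace_forms] g(1) by blast
  then have "f = g"
    using assms(3) g(2) unfolding forms_def
    by (intro poly_mapping_eqI) (metis (mono_tags, lifting) in_keys_iff mem_Collect_eq order.refl)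
  then show ?thesis
    using g(1) by simp
qed

text \<open>The approximating element of the span lives in degree d and has no coefficients in
  degree k. Consequently a nonzero form of degree d - 1 has a nonzero residue class.\<close>

lemma ideal_gen_lower_degree:
  fixes T :: "('i, 'k::field) mpoly set"
  assumes "T \<subseteq> forms d" "f \<in> ideal_gen T" "f \<in> forms k" "k < d"
  shows "f = 0"
proof -
  obtain g where g: "g \<in> kspace.span T"
    "\<And>m. mdeg m \<le> d \<Longrightarrow> Poly_Mapping.lookup f m = Poly_Mapping.lookup g m"
    using ideal_gen_forms[OF assms(1,2)] by blast
  have "g \<in> forms d"
    using kspace.span_minimal[OF assms(1) subspace_forms] g(1) by blast
  then have "Poly_Mapping.lookup f m = 0" for m
    using assms(3,4) g(2)[of m] unfolding forms_def
    by (cases "mdeg m = k") (auto simp: in_keys_iff)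
  then show ?thesis
    by (intro poly_mapping_eqI) simp
qed

lemma span_subset_ideal_gen: "kspace.span T \<subseteq> ideal_gen T"
  unfolding ideal_gen_def
  by (rule kspace.span_minimal)
    (auto intro: ideals.span_base kspace.subspaceI ideals.span_zero ideals.span_add ideals.span_scale)

lemma is_ideal_ideal_gen: "is_ideal (ideal_gen T)"
  unfolding is_ideal_def ideal_gen_def by (rule ideals.subspace_span)

text \<open>Take N with \<open>dim (U N)\<close> least. A vector of U N outside a later U n could be
  adjoined to a basis of U n, giving more than \<open>dim (U N)\<close> independent vectors inside U
  N.\<close>

lemma (in vector_space) decseq_subspaces_stabilize:
  assumes "finite B" and sub: "\<And>n :: nat. subspace (U n)" "\<And>n. U n \<subseteq> span B"
    and dec: "\<And>n. U (Suc n) \<subseteq> U n"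
  shows "\<exists>N. \<forall>n\<ge>N. U n = U N"
proof -
  define N where "N = (ARG_MIN (\<lambda>n. dim (U n)) n. True)"
  have N: "dim (U N) \<le> dim (U n)" for n
    unfolding N_def by (rule arg_min_nat_le) simp
  have "U N \<subseteq> U n" if "n \<ge> N" for n
  proof
    fix v
    assume v: "v \<in> U N"
    have le: "U n \<subseteq> U N"
      using dec that by (rule lift_Suc_antimono_le)
    obtain C where C: "C \<subseteq> U N" "independent C" "U N \<subseteq> span C" "card C = dim (U N)"
      using basis_exists .
    obtain D where D: "D \<subseteq> U n" "independent D" "U n \<subseteq> span D" "card D = dim (U n)"
      using basis_exists .
    have fin: "finite C" "finite D"
      using independent_span_bound[OF assms(1) C(2)] independent_span_bound[OF assms(1) D(2)]
        C(1) D(1) sub(2) by blast+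
    show "v \<in> U n"
    proof (rule ccontr)
      assume "v \<notin> U n"
      moreover have "span D \<subseteq> U n"
        using D(1) sub(1) by (rule span_minimal)
      ultimately have v': "v \<notin> span D" by blast
      then have "v \<notin> D"
        using span_base by blast
      have "independent (insert v D)"
        using v' D(2) by (rule independent_insertI)
      moreover have "insert v D \<subseteq> span C"
        using v le C(3) D(1) by blast
      ultimately have "card (insert v D) \<le> card C"
        using independent_span_bound[OF fin(1)] by blast
      then show False
        using N[of n] C(4) D(4) \<open>v \<notin> D\<close> fin(2) by simp
    qed
  qed
  moreover have "U n \<subseteq> U N" if "n \<ge> N" for n
    using dec that by (rule lift_Suc_antimono_le)
  ultimately show ?thesis
    by (intro exI[of _ N]) blast
qed

lemma Var_power: "Var i ^ n = monomial (Poly_Mapping.single i n)"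
proof (induction n)
  case 0
  then show ?case by (simp add: monomial_def)
next
  case (Suc n)
  have "Poly_Mapping.single i (Suc n) = Poly_Mapping.single i 1 + Poly_Mapping.single i n"
    by (simp flip: single_add)
  then show ?case
    by (simp only: power_Suc Suc monomial_add) (simp add: Var_def)
qed

lemma finite_bounded_exponents: "finite {m :: 'i::finite \<Rightarrow>\<^sub>0 nat. \<forall>i. Poly_Mapping.lookup m i \<le> n}"
proof (rule finite_imageD)
  have "finite {f :: 'i \<Rightarrow> nat. \<forall>i. (i \<in> UNIV \<longrightarrow> f i \<in> {..n}) \<and> (i \<notin> UNIV \<longrightarrow> f i = 0)}"
    by (rule finite_set_of_finite_funs) auto
  then show "finite (Poly_Mapping.lookup ` {m :: 'i \<Rightarrow>\<^sub>0 nat. \<forall>i. Poly_Mapping.lookup m i \<le> n})"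
    by (rule finite_subset[rotated]) auto
  show "inj_on Poly_Mapping.lookup {m :: 'i \<Rightarrow>\<^sub>0 nat. \<forall>i. Poly_Mapping.lookup m i \<le> n}"
    by (rule inj_onI) (rule poly_mapping_eqI, simp)
qed

lemma lookup_le_mdeg: "Poly_Mapping.lookup m i \<le> mdeg m"
proof (cases "i \<in> Poly_Mapping.keys m")
  case True
  then show ?thesis
    unfolding mdeg_def by (intro member_le_sum) auto
qed (simp add: in_keys_iff)

lemma finite_exponents_of_mdeg: "finite {m :: 'i::finite \<Rightarrow>\<^sub>0 nat. mdeg m = k}"
  by (rule finite_subset[OF _ finite_bounded_exponents[of k]]) (use lookup_le_mdeg in auto)

lemma ideal_diff: "is_ideal I \<Longrightarrow> f \<in> I \<Longrightarrow> g \<in> I \<Longrightarrow> f - g \<in> I"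
  unfolding is_ideal_def by (rule ideals.subspace_diff)

lemma ideal_add: "is_ideal I \<Longrightarrow> f \<in> I \<Longrightarrow> g \<in> I \<Longrightarrow> f + g \<in> I"
  unfolding is_ideal_def by (rule ideals.subspace_add)

lemma ideal_mult: "is_ideal I \<Longrightarrow> f \<in> I \<Longrightarrow> g * f \<in> I"
  unfolding is_ideal_def by (rule ideals.subspace_scale)

lemma ideal_0: "is_ideal I \<Longrightarrow> 0 \<in> I"
  unfolding is_ideal_def by (rule ideals.subspace_0)

lemma ideal_sum: "is_ideal I \<Longrightarrow> (\<And>x. x \<in> A \<Longrightarrow> f x \<in> I) \<Longrightarrow> sum f A \<in> I"
  unfolding is_ideal_def by (rule ideals.subspace_sum)

lemma subspace_ideal: "is_ideal (I :: ('i, 'k::field) mpoly set) \<Longrightarrow> kspace.subspace I"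
  by (rule kspace.subspaceI) (auto intro: ideal_0 ideal_add ideal_mult)

text \<open>Modulo the powers of the variables in I, every polynomial is a combination of the finitely
  many monomials with small exponents, so an ideal containing I is determined by a subspace of a
  fixed space of finite dimension.\<close>

lemma artinian_idealI:
  fixes I :: "('i::finite, 'k::field) mpoly set"
  assumes "is_ideal I" "\<And>i. Var i ^ Suc n \<in> I"
  shows "artinian_ideal I"
  unfolding artinian_ideal_def
proof (intro conjI allI impI)
  fix J :: "nat \<Rightarrow> ('i, 'k) mpoly set"
  assume J: "\<forall>k. is_ideal (J k) \<and> I \<subseteq> J k \<and> J (Suc k) \<subseteq> J k"
  define B :: "('i \<Rightarrow>\<^sub>0 nat) set" where "B = {m. \<forall>i. Poly_Mapping.lookup m i \<le> n}"
  define V :: "('i, 'k) mpoly set" where "V = kspace.span (monomial ` B)"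
  have big: "monomial m \<in> I" if m: "m \<notin> B" for m
  proof -
    obtain i where i: "Suc n \<le> Poly_Mapping.lookup m i"
      using m by (auto simp: B_def not_le Suc_le_eq)
    have "m = (m - Poly_Mapping.single i (Suc n)) + Poly_Mapping.single i (Suc n)"
      by (rule poly_mapping_eqI) (use i in \<open>auto simp: lookup_add lookup_minus lookup_single when_def\<close>)
    then have "monomial m = monomial (m - Poly_Mapping.single i (Suc n)) * Var i ^ Suc n"
      by (simp only: Var_power flip: monomial_add)
    then show ?thesis
      using ideal_mult[OF assms(1) assms(2)[of i]] by metis
  qed
  have decomp: "\<exists>g\<in>V. f - g \<in> I" for f :: "('i, 'k) mpoly"
  proof -
    let ?t = "\<lambda>m. Const (Poly_Mapping.lookup f m) * monomial m"
    define g h where "g = (\<Sum>m\<in>Poly_Mapping.keys f \<inter> B. ?t m)"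
      and "h = (\<Sum>m\<in>Poly_Mapping.keys f - B. ?t m)"
    have "g \<in> V"
      unfolding g_def V_def by (intro kspace.span_sum kspace.span_scale kspace.span_base) auto
    moreover have "h \<in> I"
      unfolding h_def by (intro ideal_sum ideal_mult assms(1) big) auto
    moreover have "f = g + h"
      unfolding g_def h_def by (subst poly_eq_sum_monomials) (rule sum.Int_Diff, simp)
    then have "f - g = h" by simp
    ultimately show ?thesis by blast
  qed
  have "\<exists>N. \<forall>k\<ge>N. J k \<inter> V = J N \<inter> V"
  proof (rule kspace.decseq_subspaces_stabilize)
    show "finite (monomial ` B :: ('i, 'k) mpoly set)"
      unfolding B_def using finite_bounded_exponents by blast
    show "kspace.subspace (J k \<inter> V)" for k
      using J subspace_ideal unfolding V_def by (intro kspace.subspace_inter) auto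
    show "J k \<inter> V \<subseteq> kspace.span (monomial ` B)" for k
      by (auto simp: V_def)
    show "J (Suc k) \<inter> V \<subseteq> J k \<inter> V" for k
      using J by blast
  qed
  then obtain N where N: "\<And>k. k \<ge> N \<Longrightarrow> J k \<inter> V = J N \<inter> V"
    by blast
  have "J k = J l" if "J k \<inter> V = J l \<inter> V" for k l
  proof -
    have "J k \<subseteq> J l" if "J k \<inter> V = J l \<inter> V" for k l
    proof
      fix f
      assume f: "f \<in> J k"
      obtain g where g: "g \<in> V" "f - g \<in> I"
        using decomp by blast
      then have "f - (f - g) \<in> J k"
        using J f by (metis ideal_diff subsetD)
      then have "g \<in> J l"
        using that g(1) by auto
      then have "(f - g) + g \<in> J l"
        using J g(2) by (metis ideal_add subsetD)
      then show "f \<in> J l" by simp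
    qed
    then show ?thesis
      using that by (metis subset_antisym)
  qed
  then show "\<exists>N. \<forall>k\<ge>N. J k = J N"
    using N by metis
qed (fact assms(1))

section \<open>Residue classes and multiplication on the quotient\<close>

lemma residue_class_eq_iff:
  assumes "is_ideal I"
  shows "residue_class I f = residue_class I g \<longleftrightarrow> f - g \<in> I"
proof
  assume "residue_class I f = residue_class I g"
  moreover have "f + 0 \<in> residue_class I f"
    using ideal_0[OF assms] unfolding residue_class_def by blast
  ultimately obtain h where "h \<in> I" "f = g + h"
    by (auto simp: residue_class_def)
  then show "f - g \<in> I" by simp
next
  have sub: "residue_class I f \<subseteq> residue_class I g" if "f - g \<in> I" for f g
  proof
    fix x
    assume "x \<in> residue_class I f"
    then obtain h where h: "h \<in> I" "x = f + h"
      by (auto simp: residue_class_def)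
    then have "x = g + ((f - g) + h)" by simp
    moreover have "(f - g) + h \<in> I"
      using assms that h(1) by (rule ideal_add)
    ultimately show "x \<in> residue_class I g"
      unfolding residue_class_def by blast
  qed
  assume *: "f - g \<in> I"
  have "- 1 * (f - g) \<in> I"
    using assms * by (rule ideal_mult)
  then show "residue_class I f = residue_class I g"
    using sub[OF *] sub[of g f] by simp
qed

lemma quot_times_residue_class:
  assumes "is_ideal I"
  shows "quot_times I L (residue_class I f) = residue_class I (L * f)"
proof -
  have "residue_class I (L * g) = residue_class I (L * f)" if g: "g \<in> residue_class I f" for g
  proof -
    obtain h where "h \<in> I" "g = f + h"
      using g by (auto simp: residue_class_def)
    then show ?thesis
      using ideal_mult[OF assms, of h L] by (simp add: residue_class_eq_iff[OF assms] distrib_left)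
  qed
  moreover have "f + 0 \<in> residue_class I f"
    using ideal_0[OF assms] unfolding residue_class_def by blast
  ultimately show ?thesis
    unfolding quot_times_def by (intro SUP_eq_const) blast+
qed

section \<open>Three variables\<close>

lemma exhaust_ternary: "i = 0 \<or> i = 1 \<or> i = (2 :: 3)"
proof (induct i)
  case (of_int z)
  then have "0 \<le> z" "z < 3" by simp_all
  then have "z = 0 \<or> z = 1 \<or> z = 2" by arith
  then show ?case by auto
qed

lemma UNIV_ternary: "UNIV = {0, 1, 2 :: 3}"
  using exhaust_ternary by auto

lemma ternary_distinct [simp]:
  "(0 :: 3) \<noteq> 1" "(1 :: 3) \<noteq> 0" "(0 :: 3) \<noteq> 2" "(2 :: 3) \<noteq> 0" "(1 :: 3) \<noteq> 2" "(2 :: 3) \<noteq> 1"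
  by auto

lemma sum_ternary: "sum f (UNIV :: 3 set) = f 0 + f 1 + f 2"
  unfolding UNIV_ternary by (simp add: add.assoc)

lemma prod_ternary: "prod f (UNIV :: 3 set) = f 0 * f 1 * f 2"
  unfolding UNIV_ternary by (simp add: mult.assoc)

lemma mdeg_ternary:
  "mdeg m = Poly_Mapping.lookup m 0 + Poly_Mapping.lookup m 1 + Poly_Mapping.lookup m (2 :: 3)"
  using mdeg_superset[of UNIV m] by (simp add: sum_ternary)

lemma monomial_value_ternary:
  "monomial_value v m = v 0 ^ Poly_Mapping.lookup m 0 * v 1 ^ Poly_Mapping.lookup m 1
    * v (2 :: 3) ^ Poly_Mapping.lookup m 2"
  using monomial_value_superset[of UNIV m v] by (simp add: prod_ternary)

definition expo :: "nat \<Rightarrow> nat \<Rightarrow> nat \<Rightarrow> 3 \<Rightarrow>\<^sub>0 nat"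
  where "expo i j k = Poly_Mapping.single 0 i + Poly_Mapping.single 1 j + Poly_Mapping.single 2 k"

lemma lookup_expo [simp]:
  "Poly_Mapping.lookup (expo i j k) 0 = i" "Poly_Mapping.lookup (expo i j k) 1 = j"
  "Poly_Mapping.lookup (expo i j k) 2 = k"
  by (simp_all add: expo_def lookup_add lookup_single when_def)

lemma mdeg_expo [simp]: "mdeg (expo i j k) = i + j + k"
  by (simp add: mdeg_ternary)

lemma ternary_expo_eqI:
  assumes "Poly_Mapping.lookup m 0 = Poly_Mapping.lookup n 0"
    "Poly_Mapping.lookup m 1 = Poly_Mapping.lookup n 1"
    "Poly_Mapping.lookup m 2 = Poly_Mapping.lookup n (2 :: 3)"
  shows "m = n"
proof (rule poly_mapping_eqI)
  show "Poly_Mapping.lookup m i = Poly_Mapping.lookup n i" for i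
    using exhaust_ternary[of i] assms by auto
qed

text \<open>Substituting x = t, y = t^D, z = t^(D^2) with D exceeding all exponents separates the
  monomials.\<close>

lemma ternary_nonvanishing:
  fixes f :: "'k::field_char_0 ternary"
  assumes "f \<noteq> 0"
  obtains v where "peval v f \<noteq> 0"
proof -
  define D where "D = Suc (\<Sum>m\<in>Poly_Mapping.keys f. mdeg m)"
  have D: "Poly_Mapping.lookup m i < D" if "m \<in> Poly_Mapping.keys f" for m i
  proof -
    have "Poly_Mapping.lookup m i \<le> mdeg m"
      by (rule lookup_le_mdeg)
    also have "\<dots> \<le> (\<Sum>m\<in>Poly_Mapping.keys f. mdeg m)"
      using that by (intro member_le_sum) auto
    finally show ?thesis by (simp add: D_def)
  qed
  \<comment> \<open>The exponents of m are the base D digits of \<open>N m\<close>, so they can be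
    recovered by division and distinct monomials of f give distinct powers of t.\<close>
  define N where "N m = Poly_Mapping.lookup m 0
    + D * (Poly_Mapping.lookup m 1 + D * Poly_Mapping.lookup m (2 :: 3))" for m
  have digits: "N m mod D = Poly_Mapping.lookup m 0" "N m div D mod D = Poly_Mapping.lookup m 1"
    "N m div D div D = Poly_Mapping.lookup m 2" if "m \<in> Poly_Mapping.keys f" for m
  proof -
    have "D \<noteq> 0" by (simp add: D_def)
    then have "N m div D = Poly_Mapping.lookup m 1 + D * Poly_Mapping.lookup m 2"
      using D[OF that, of 0] unfolding N_def by simp
    then show "N m div D mod D = Poly_Mapping.lookup m 1" "N m div D div D = Poly_Mapping.lookup m 2"
      using D[OF that, of 1] \<open>D \<noteq> 0\<close> by simp_all
    show "N m mod D = Poly_Mapping.lookup m 0"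
      using D[OF that, of 0] unfolding N_def by simp
  qed
  have inj: "m = n" if "m \<in> Poly_Mapping.keys f" "n \<in> Poly_Mapping.keys f" "N m = N n" for m n
    using digits[OF that(1)] digits[OF that(2)] that(3) by (intro ternary_expo_eqI) simp_all
  define p where "p = (\<Sum>m\<in>Poly_Mapping.keys f. monom (Poly_Mapping.lookup f m) (N m))"
  obtain n where n: "n \<in> Poly_Mapping.keys f"
    using assms by fastforce
  have "coeff p (N n) = (\<Sum>m\<in>Poly_Mapping.keys f. if m = n then Poly_Mapping.lookup f m else 0)"
    unfolding p_def coeff_sum by (rule sum.cong) (use inj n in auto)
  also have "\<dots> \<noteq> 0"
    using n by (simp add: in_keys_iff)
  finally have "p \<noteq> 0" by auto
  \<comment> \<open>A nonzero polynomial in one variable has a nonroot because the field is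
    infinite; characteristic zero enters here.\<close>
  then obtain t where "poly p t \<noteq> 0"
    using poly_all_0_iff_0 by blast
  define w where "w i = (if i = 0 then t else if i = 1 then t ^ D else t ^ (D * D))" for i :: 3
  have "monomial_value w m = t ^ N m" for m
    unfolding monomial_value_ternary w_def N_def
    by (simp add: distrib_left add.assoc mult.assoc flip: power_mult power_add)
  then have "poly p t = peval w f"
    unfolding p_def peval_altdef poly_sum poly_monom by simp
  then show ?thesis
    using that \<open>poly p t \<noteq> 0\<close> by metis
qed

text \<open>Surjectivity is excluded by counting: because of the relation, L R_k + I_(k+1) is spanned by
  fewer elements than there are monomials of degree k + 1.\<close>

lemma not_times_max_rankI:
  fixes S :: "'k::field ternary set"
  assumes S: "S \<subseteq> forms (Suc k)" "finite S" "card S \<le> k + 2"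
    and L: "L \<in> forms 1" and F: "F \<in> forms k" "F \<noteq> 0" "L * F \<in> ideal_gen S"
  shows "\<not> times_max_rank (ideal_gen S) L k"
proof -
  define I where "I = ideal_gen S"
  have I: "is_ideal I"
    unfolding I_def by (rule is_ideal_ideal_gen)
  have "F \<notin> I"
    using ideal_gen_lower_degree[OF S(1) _ F(1)] F(2) by (auto simp: I_def)
  then have "residue_class I F \<noteq> residue_class I 0"
    by (simp add: residue_class_eq_iff[OF I])
  moreover have "quot_times I L (residue_class I F) = quot_times I L (residue_class I 0)"
    using F(3) by (simp add: quot_times_residue_class[OF I] residue_class_eq_iff[OF I] flip: I_def)
  ultimately have not_inj: "\<not> inj_on (quot_times I L) (quot_component I k)"
    using F(1) forms_0 unfolding quot_component_def inj_on_def by (metis imageI)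
  define M where "M j = {m :: 3 \<Rightarrow>\<^sub>0 nat. mdeg m = j}" for j
  have fin: "finite (M j)" for j
    unfolding M_def by (rule finite_exponents_of_mdeg)
  obtain m0 where m0: "m0 \<in> Poly_Mapping.keys F"
    using F(2) by fastforce
  have m0_M: "m0 \<in> M k"
    using m0 F(1) by (auto simp: forms_def M_def)
  \<comment> \<open>m0 may be any monomial of F: the relation expresses L * m0 through the other
    products and S. Leaving it out saves the one element on which the count depends.\<close>
  define T where "T = (\<lambda>m. L * monomial m) ` (M k - {m0}) \<union> S"
  have "quot_times I L ` quot_component I k \<noteq> quot_component I (Suc k)"
  proof
    assume surj: "quot_times I L ` quot_component I k = quot_component I (Suc k)"
    have LF: "L * F \<in> kspace.span T"
    proof -
      have "L * F \<in> forms (Suc k)"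
        using forms_mult[OF L F(1)] by simp
      then have "L * F \<in> kspace.span S"
        using ideal_gen_Int_forms[OF S(1) F(3)] by blast
      then show ?thesis
        using kspace.span_mono[of S T] by (auto simp: T_def)
    qed
    have other: "L * monomial m \<in> kspace.span T" if "m \<in> M k" "m \<noteq> m0" for m
      using that by (intro kspace.span_base) (auto simp: T_def)
    have "L * monomial m0 \<in> kspace.span T"
    proof -
      define c G where "c = Poly_Mapping.lookup F m0"
        and "G = (\<Sum>m\<in>Poly_Mapping.keys F - {m0}. Const (Poly_Mapping.lookup F m) * monomial m)"
      have "c \<noteq> 0"
        using m0 by (simp add: c_def in_keys_iff)
      have "F = Const c * monomial m0 + G"
        unfolding c_def G_def by (subst poly_eq_sum_monomials) (rule sum.remove[OF _ m0], simp)
      then have F_eq: "L * F = L * (Const c * monomial m0) + L * G"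
        by (simp only: distrib_left)
      have "L * G = (\<Sum>m\<in>Poly_Mapping.keys F - {m0}.
          Const (Poly_Mapping.lookup F m) * (L * monomial m))"
        unfolding G_def sum_distrib_left by (rule sum.cong[OF refl mult.left_commute])
      also have "\<dots> \<in> kspace.span T"
        by (intro kspace.span_sum kspace.span_scale other) (use F(1) in \<open>auto simp: forms_def M_def\<close>)
      finally have "L * (Const c * monomial m0) \<in> kspace.span T"
        using kspace.span_add_eq2 LF unfolding F_eq by blast
      then have "Const (inverse c) * (L * (Const c * monomial m0)) \<in> kspace.span T"
        by (rule kspace.span_scale)
      moreover have "Const (inverse c) * (L * (Const c * monomial m0))
          = Const (inverse c * c) * (L * monomial m0)"
        by (simp only: Const_mult mult.assoc mult.left_commute)
      ultimately show ?thesis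
        by (simp only: left_inverse[OF \<open>c \<noteq> 0\<close>] Const_1 mult_1_left)
    qed
    then have mono: "L * monomial m \<in> kspace.span T" if "m \<in> M k" for m
      using other that by blast
    have mult: "L * g \<in> kspace.span T" if "g \<in> forms k" for g
    proof -
      have "L * g = L * (\<Sum>m\<in>Poly_Mapping.keys g. Const (Poly_Mapping.lookup g m) * monomial m)"
        by (simp only: poly_eq_sum_monomials[symmetric])
      also have "\<dots> = (\<Sum>m\<in>Poly_Mapping.keys g. Const (Poly_Mapping.lookup g m) * (L * monomial m))"
        unfolding sum_distrib_left by (rule sum.cong[OF refl mult.left_commute])
      also have "\<dots> \<in> kspace.span T"
        by (intro kspace.span_sum kspace.span_scale mono) (use that in \<open>auto simp: forms_def M_def\<close>)
      finally show ?thesis .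
    qed
    have span: "f \<in> kspace.span T" if f: "f \<in> forms (Suc k)" for f
    proof -
      have "residue_class I f \<in> quot_component I (Suc k)"
        unfolding quot_component_def using f by blast
      then have "residue_class I f \<in> quot_times I L ` quot_component I k"
        by (simp only: surj)
      then obtain g where g: "g \<in> forms k" "residue_class I f = residue_class I (L * g)"
        by (auto simp: quot_component_def quot_times_residue_class[OF I])
      then have "f - L * g \<in> I"
        by (simp add: residue_class_eq_iff[OF I])
      moreover have "f - L * g \<in> forms (Suc k)"
        using f forms_mult[OF L g(1)] by (intro forms_diff) auto
      ultimately have "f - L * g \<in> kspace.span S"
        unfolding I_def by (rule ideal_gen_Int_forms[OF S(1)])
      then have "f - L * g \<in> kspace.span T"
        using kspace.span_mono[of S T] by (auto simp: T_def)
      then have "(f - L * g) + L * g \<in> kspace.span T"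
        using mult[OF g(1)] by (rule kspace.span_add)
      then show ?thesis by simp
    qed
    have "card (monomial ` M (Suc k) :: 'k ternary set) \<le> card T"
    proof -
      have "finite T"
        unfolding T_def using fin S(2) by blast
      moreover have "monomial ` M (Suc k) \<subseteq> kspace.span T"
        using span by (auto simp: M_def)
      ultimately show ?thesis
        using kspace.independent_span_bound[OF _ independent_monomials] by blast
    qed
    also have "card T \<le> card ((\<lambda>m. L * monomial m) ` (M k - {m0})) + card S"
      unfolding T_def by (rule card_Un_le)
    also have "\<dots> \<le> (card (M k) - 1) + (k + 2)"
      using card_image_le[of "M k - {m0}" "\<lambda>m. L * monomial m"] fin[of k] m0_M S(3) by simp
    also have "\<dots> < card (M k) + (k + 2)"
    proof -
      have "card (M k) > 0"
        using fin[of k] m0_M by (auto simp: card_gt_0_iff)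
      then show ?thesis by simp
    qed
    \<comment> \<open>The multiples of x of degree k + 1 correspond to \<open>M k\<close>, and there
      are k + 2 monomials in y and z alone; together these are the monomials of degree k +
      1.\<close>
    also have "\<dots> = card ((\<lambda>m. Poly_Mapping.single 0 1 + m) ` M k)
        + card ((\<lambda>j. expo 0 j (Suc k - j)) ` {..Suc k})"
    proof -
      have "inj_on (\<lambda>j. expo 0 j (Suc k - j)) {..Suc k}"
        by (rule inj_onI) (metis lookup_expo(2))
      then show ?thesis
        by (simp add: card_image)
    qed
    also have "\<dots> = card ((\<lambda>m. Poly_Mapping.single 0 1 + m) ` M k
        \<union> (\<lambda>j. expo 0 j (Suc k - j)) ` {..Suc k})"
    proof (rule card_Un_disjoint[symmetric])
      have "Poly_Mapping.lookup (Poly_Mapping.single 0 1 + m) 0 \<noteq> Poly_Mapping.lookup (expo 0 i j) 0"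
        for m :: "3 \<Rightarrow>\<^sub>0 nat" and i j
        by (simp add: lookup_add)
      then show "(\<lambda>m. Poly_Mapping.single 0 1 + m) ` M k \<inter> (\<lambda>j. expo 0 j (Suc k - j)) ` {..Suc k} = {}"
        by (metis (no_types, lifting) disjoint_iff imageE)
    qed (use fin in auto)
    also have "\<dots> \<le> card (M (Suc k))"
      by (rule card_mono[OF fin]) (auto simp: M_def mdeg_add)
    also have "\<dots> = card (monomial ` M (Suc k) :: 'k ternary set)"
      by (rule card_image[symmetric]) (rule inj_on_subset[OF inj_monomial], simp)
    finally show False by simp
  qed
  then show ?thesis
    using not_inj by (simp add: times_max_rank_def I_def)
qed

section \<open>The diagonal action and its invariants\<close>

lemma primitive_root_power_mod:
  assumes "primitive_root_of_unity d e"
  shows "e ^ n = e ^ (n mod d)"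
proof -
  have "e ^ n = (e ^ d) ^ (n div d) * e ^ (n mod d)"
    by (simp flip: power_mult power_add)
  then show ?thesis
    using assms by (simp add: primitive_root_of_unity_def)
qed

lemma primitive_root_power_eq_1_iff:
  assumes "primitive_root_of_unity d e" "d > 0"
  shows "e ^ n = 1 \<longleftrightarrow> d dvd n"
  using primitive_root_power_mod[OF assms(1), of n] assms mod_less_divisor[OF assms(2), of n]
  unfolding primitive_root_of_unity_def by (metis dvd_eq_mod_eq_0 gr0I power_0)

lemma primitive_root_nonzero:
  assumes "primitive_root_of_unity d e" "d > 0"
  shows "e \<noteq> 0"
  using assms by (auto simp: primitive_root_of_unity_def power_0_left)

lemma primitive_root_power_eq_iff:
  assumes "primitive_root_of_unity d e" "d > 0"
  shows "e ^ m = e ^ n \<longleftrightarrow> m mod d = n mod d"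
proof
  have le: "m mod d = n mod d" if "e ^ m = e ^ n" "m \<le> n" for m n
  proof -
    have "e ^ m * e ^ (n - m) = e ^ n"
      using that(2) by (simp flip: power_add)
    then have "e ^ m * e ^ (n - m) = e ^ m"
      using that(1) by simp
    then have "e ^ (n - m) = 1"
      using primitive_root_nonzero[OF assms] by simp
    then show ?thesis
      using that(2) mod_eq_dvd_iff_nat[of m n d] by (simp add: primitive_root_power_eq_1_iff[OF assms])
  qed
  show "m mod d = n mod d" if "e ^ m = e ^ n"
    using le[OF that] le[OF that[symmetric], symmetric] nat_le_linear[of m n] by blast
  show "e ^ m = e ^ n" if "m mod d = n mod d"
    using that primitive_root_power_mod[OF assms(1)] by metis
qed

text \<open>X^d - 1 has at most d roots, and the d distinct powers of e already exhaust
  them.\<close>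

lemma root_of_unity_power_of_primitive:
  fixes e :: "'k::field"
  assumes e: "primitive_root_of_unity d e" "d > 0" and x: "x ^ d = 1"
  obtains n where "x = e ^ n"
proof -
  define p :: "'k poly" where "p = monom 1 d - 1"
  have p: "poly p y = y ^ d - 1" for y
    by (simp add: p_def poly_monom)
  have "coeff p d = 1"
    using e(2) by (simp add: p_def)
  then have "p \<noteq> 0" by auto
  have "degree p \<le> d"
    unfolding p_def by (rule degree_diff_le) (auto simp: degree_monom_le)
  have inj: "inj_on (\<lambda>n. e ^ n) {..<d}"
    by (rule inj_onI) (simp add: primitive_root_power_eq_iff[OF e])
  have "(\<lambda>n. e ^ n) ` {..<d} = {y. poly p y = 0}"
  proof (rule card_seteq)
    show "finite {y. poly p y = 0}"
      using \<open>p \<noteq> 0\<close> by (rule poly_roots_finite)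
    have "(e ^ n) ^ d = 1" for n
      using e(1) by (metis power_mult mult.commute power_one primitive_root_of_unity_def)
    then show "(\<lambda>n. e ^ n) ` {..<d} \<subseteq> {y. poly p y = 0}"
      by (auto simp: p)
    have "card {y. poly p y = 0} \<le> degree p"
      using \<open>p \<noteq> 0\<close> by (intro card_poly_roots_bound) auto
    then show "card {y. poly p y = 0} \<le> card ((\<lambda>n. e ^ n) ` {..<d})"
      using \<open>degree p \<le> d\<close> by (simp add: card_image[OF inj])
  qed
  moreover have "x \<in> {y. poly p y = 0}"
    using x by (simp add: p)
  ultimately show ?thesis
    using that by blast
qed

section \<open>Eigenvalues of the action on monomials\<close>

definition weight :: "nat \<Rightarrow> nat \<Rightarrow> 3 \<Rightarrow> nat"
  where "weight a b i = (if i = 0 then 0 else if i = 1 then a else b)"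

lemma weight_simps [simp]: "weight a b 0 = 0" "weight a b 1 = a" "weight a b 2 = b"
  by (simp_all add: weight_def)

text \<open>The exponent of the eigenvalue: \<open>M_action c a b\<close> multiplies
  \<open>monomial m\<close> by c to this power.\<close>

definition weighted_degree :: "nat \<Rightarrow> nat \<Rightarrow> (3 \<Rightarrow>\<^sub>0 nat) \<Rightarrow> nat"
  where "weighted_degree a b m = a * Poly_Mapping.lookup m 1 + b * Poly_Mapping.lookup m 2"

lemma monomial_value_mult:
  "monomial_value (\<lambda>i. f i * g i) m = monomial_value f m * monomial_value g m"
  by (simp add: monomial_value_def power_mult_distrib prod.distrib)

lemma Const_power: "Const (c ^ n) = Const c ^ n"
  by (induction n) (simp_all add: Const_mult)

lemma Const_prod: "Const (\<Prod>x\<in>A. f x) = (\<Prod>x\<in>A. Const (f x))"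
  by (induction A rule: infinite_finite_induct) (simp_all add: Const_mult)

lemma monomial_value_Const: "monomial_value (\<lambda>i. Const (h i)) m = Const (monomial_value h m)"
  by (simp add: monomial_value_def Const_prod Const_power)

lemma monomial_sum: "monomial (\<Sum>x\<in>A. f x) = (\<Prod>x\<in>A. monomial (f x))"
proof (induction A rule: infinite_finite_induct)
  case (insert x A)
  then show ?case by (simp add: monomial_add)
qed (simp_all add: monomial_def)

lemma monomial_value_Var: "monomial_value Var m = (monomial m :: ('i, 'k::comm_ring_1) mpoly)"
proof -
  have "(monomial m :: ('i, 'k) mpoly) = monomial (\<Sum>i\<in>Poly_Mapping.keys m. Poly_Mapping.single i (Poly_Mapping.lookup m i))"
    by (simp only: poly_mapping_eq_sum_single[symmetric])
  then show ?thesis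
    by (simp only: monomial_value_def Var_power monomial_sum)
qed

lemma monomial_value_weight: "monomial_value (\<lambda>i. c ^ weight a b i) m = c ^ weighted_degree a b m"
  by (simp add: monomial_value_ternary weighted_degree_def power_add power_mult)

lemma M_action_altdef: "M_action c a b = psubst (\<lambda>i. Const (c ^ weight a b i) * Var i)"
proof -
  have "(if i = 0 then Var 0 else if i = 1 then Const (c ^ a) * Var 1 else Const (c ^ b) * Var 2)
      = Const (c ^ weight a b i) * Var i" for i
    using exhaust_ternary[of i] by auto
  then show ?thesis
    unfolding M_action_def by (intro arg_cong[of _ _ psubst] ext)
qed

text \<open>The action is diagonal in the basis of monomials, so composition, injectivity and
  invariance can all be read off coefficientwise.\<close>

lemma lookup_M_action:
  "Poly_Mapping.lookup (M_action c a b f) m = c ^ weighted_degree a b m * Poly_Mapping.lookup f m"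
proof -
  have "M_action c a b f = (\<Sum>n\<in>Poly_Mapping.keys f. Const (Poly_Mapping.lookup f n) *
      (Const (c ^ weighted_degree a b n) * monomial n))"
    unfolding M_action_altdef psubst_def eval_via_altdef monomial_value_mult monomial_value_Const
      monomial_value_Var monomial_value_weight ..
  then have "Poly_Mapping.lookup (M_action c a b f) m = (\<Sum>n\<in>Poly_Mapping.keys f.
      Poly_Mapping.lookup f n * (c ^ weighted_degree a b n * Poly_Mapping.lookup (monomial n) m))"
    by (simp only: lookup_sum lookup_Const_mult)
  also have "\<dots> = (\<Sum>n\<in>Poly_Mapping.keys f.
      if m = n then c ^ weighted_degree a b n * Poly_Mapping.lookup f n else 0)"
    by (rule sum.cong) (auto simp: lookup_monomial)
  also have "\<dots> = c ^ weighted_degree a b m * Poly_Mapping.lookup f m"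
    by (simp add: in_keys_iff)
  finally show ?thesis .
qed

lemma M_action_prod: "M_action c a b (\<Prod>x\<in>A. f x) = (\<Prod>x\<in>A. M_action c a b (f x))"
  unfolding M_action_altdef psubst_def by (rule Const_hom.eval_via_prod)

lemma M_action_M_action: "M_action c a b (M_action c' a b f) = M_action (c * c') a b f"
  by (rule poly_mapping_eqI) (simp add: lookup_M_action power_mult_distrib mult.assoc)

lemma M_action_1: "M_action 1 a b f = f"
  by (rule poly_mapping_eqI) (simp add: lookup_M_action)

lemma M_action_forms: "f \<in> forms k \<Longrightarrow> M_action c a b f \<in> forms k"
  by (auto simp: forms_def in_keys_iff lookup_M_action)

lemma M_action_eq_0_iff: "c \<noteq> 0 \<Longrightarrow> M_action c a b f = 0 \<longleftrightarrow> f = 0"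
  by (auto simp: poly_mapping_eq_iff fun_eq_iff lookup_M_action)

definition invariant_exponents :: "nat \<Rightarrow> nat \<Rightarrow> nat \<Rightarrow> (3 \<Rightarrow>\<^sub>0 nat) set"
  where "invariant_exponents a b d = {m. mdeg m = d \<and> d dvd weighted_degree a b m}"

text \<open>A nonzero coefficient is fixed only if its eigenvalue, a power of e, is 1. Thus
  invariant polynomials are combinations of invariant monomials.\<close>

lemma keys_M_action_invariant:
  assumes "primitive_root_of_unity d e" "d > 0"
    and "M_action e a b f = f" "m \<in> Poly_Mapping.keys f"
  shows "d dvd weighted_degree a b m"
proof -
  have "e ^ weighted_degree a b m * Poly_Mapping.lookup f m = Poly_Mapping.lookup f m"
    using lookup_M_action[of e a b f m] assms(3) by simp
  then show ?thesis
    using assms by (simp add: in_keys_iff primitive_root_power_eq_1_iff)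
qed

lemma invariant_monomials_eq:
  assumes "primitive_root_of_unity d e" "d > 0"
  shows "invariant_monomials e a b d = monomial ` invariant_exponents a b d"
proof -
  have "M_action e a b (monomial m) = monomial m \<longleftrightarrow> d dvd weighted_degree a b m" for m
  proof
    assume "M_action e a b (monomial m) = monomial m"
    then show "d dvd weighted_degree a b m"
      using keys_M_action_invariant[OF assms, of a b "monomial m" m] by simp
  next
    assume "d dvd weighted_degree a b m"
    then show "M_action e a b (monomial m) = monomial m"
      using primitive_root_power_eq_1_iff[OF assms, of "weighted_degree a b m"]
      by (intro poly_mapping_eqI) (auto simp: lookup_M_action lookup_monomial)
  qed
  then show ?thesis
    by (auto simp: invariant_monomials_def invariant_exponents_def)
qed

section \<open>Counting solutions of the weight congruence modulo d\<close>

lemma bezout_three: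
  assumes "gcd a (gcd b d) = (1 :: nat)"
  obtains u v w :: int where "u * int a + v * int b + w * int d = 1"
proof -
  obtain u t where 1: "u * int a + t * int (gcd b d) = gcd (int a) (int (gcd b d))"
    using bezout_int by blast
  obtain v w where 2: "v * int b + w * int d = gcd (int b) (int d)"
    using bezout_int by blast
  have "u * int a + t * (v * int b + w * int d) = 1"
    using 1 2 assms by (simp add: gcd_int_int_eq)
  then have "u * int a + (t * v) * int b + (t * w) * int d = 1"
    by (simp add: algebra_simps)
  then show ?thesis by (rule that)
qed

text \<open>The solutions are the multiples of (b, -a).\<close>

lemma weight_solutions_cyclic:
  fixes j k u v w d a b :: int
  assumes "u * a + v * b + w * d = 1" "d dvd a * j + b * k"
  shows "d dvd j - b * (v * j - u * k)" "d dvd k + a * (v * j - u * k)"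
proof -
  \<comment> \<open>The multiplier is n = v j - u k, and the claim is (j, k) = n (b, -a) modulo d.
    The first summand is divisible by d by the weight congruence, the last vanishes by the Bezout
    relation.\<close>
  have "j - b * (v * j - u * k) = u * (a * j + b * k) + d * (w * j)
      + j * (1 - (u * a + v * b + w * d))"
    by (simp add: algebra_simps)
  then show "d dvd j - b * (v * j - u * k)"
    using assms by simp
  have "k + a * (v * j - u * k) = v * (a * j + b * k) + d * (w * k)
      + k * (1 - (u * a + v * b + w * d))"
    by (simp add: algebra_simps)
  then show "d dvd k + a * (v * j - u * k)"
    using assms by simp
qed

text \<open>The residue of v j - u k modulo d is the multiplier of (b, -a) that yields (j, k). It
  therefore determines the solution, and there are d residues.\<close>

lemma card_weight_solutions:
  fixes a b d :: nat
  assumes "gcd a (gcd b d) = 1" "d > 0"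
  shows "card {(j, k). j < d \<and> k < d \<and> d dvd a * j + b * k} \<le> d"
proof -
  obtain u v w :: int where uvw: "u * int a + v * int b + w * int d = 1"
    using bezout_three[OF assms(1)] .
  define H where "H = {(j, k). j < d \<and> k < d \<and> d dvd a * j + b * k}"
  define h where "h = (\<lambda>(j, k). (v * int j - u * int k) mod int d)"
  have "inj_on h H"
  proof (rule inj_onI, clarify)
    fix j k j' k'
    assume H: "(j, k) \<in> H" "(j', k') \<in> H" and h: "h (j, k) = h (j', k')"
    let ?n = "v * int j - u * int k" and ?n' = "v * int j' - u * int k'"
    have n: "int d dvd ?n - ?n'"
      using h by (simp add: h_def mod_eq_dvd_iff)
    have sol: "int d dvd int a * int j + int b * int k" "int d dvd int a * int j' + int b * int k'"
      using H by (simp_all only: H_def mem_Collect_eq prod.case of_nat_dvd_iff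
          of_nat_mult[symmetric] of_nat_add[symmetric])
    note c = weight_solutions_cyclic[OF uvw sol(1)] weight_solutions_cyclic[OF uvw sol(2)]
    have "int j - int j' = (int j - int b * ?n) - (int j' - int b * ?n') + int b * (?n - ?n')"
      by (simp add: algebra_simps)
    then have j: "int d dvd int j - int j'"
      using c n by (metis dvd_add dvd_diff dvd_mult)
    have "int k - int k' = (int k + int a * ?n) - (int k' + int a * ?n') - int a * (?n - ?n')"
      by (simp add: algebra_simps)
    then have k: "int d dvd int k - int k'"
      using c n by (metis dvd_diff dvd_mult)
    have "int j mod int d = int j' mod int d" "int k mod int d = int k' mod int d"
      using j k by (simp_all add: mod_eq_dvd_iff)
    then show "j = j' \<and> k = k'"
      using H by (simp add: H_def)
  qed
  then have "card H = card (h ` H)"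
    by (simp add: card_image)
  also have "\<dots> \<le> card {0..<int d}"
    using assms(2) by (intro card_mono) (auto simp: h_def)
  finally show ?thesis
    by (simp add: H_def)
qed

lemma finite_invariant_exponents: "finite (invariant_exponents a b d)"
  by (rule finite_subset[OF _ finite_exponents_of_mdeg[of d]]) (auto simp: invariant_exponents_def)

text \<open>Identify an invariant monomial with its exponents (j, k) of y and z. Apart from (d, 0) and
  (0, d), these are solutions of a j + b k = 0 in the square {0..<d} x {0..<d} with j + k at most d,
  and the solution (b, d - a) is not of this kind.\<close>

lemma card_invariant_exponents:
  assumes "1 \<le> a" "a < b" "b < d" "gcd a (gcd b d) = 1"
  shows "card (invariant_exponents a b d) \<le> d + 1"
proof -
  define H where "H = {(j, k). j < d \<and> k < d \<and> d dvd a * j + b * k}"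
  define h where "h m = (Poly_Mapping.lookup m 1, Poly_Mapping.lookup m (2 :: 3))"
    for m :: "3 \<Rightarrow>\<^sub>0 nat"
  let ?E = "invariant_exponents a b d - {expo 0 d 0, expo 0 0 d}"
  have finH: "finite H"
    by (rule finite_subset[of _ "{..<d} \<times> {..<d}"]) (auto simp: H_def)
  have "int a * int b + int b * int (d - a) = int d * int b"
    using assms by (simp add: of_nat_diff algebra_simps)
  then have "a * b + b * (d - a) = d * b"
    by (simp flip: of_nat_mult of_nat_add)
  \<comment> \<open>Its coordinate sum b + (d - a) exceeds d because a < b, which puts this solution
    outside the triangle.\<close>
  then have mem: "(b, d - a) \<in> H"
    using assms by (simp add: H_def)
  have "inj_on h (invariant_exponents a b d)"
    by (rule inj_onI)
      (auto simp: h_def invariant_exponents_def mdeg_ternary intro!: ternary_expo_eqI)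
  then have "card ?E = card (h ` ?E)"
    by (metis card_image Diff_subset inj_on_subset)
  also have "h ` ?E \<subseteq> H - {(b, d - a)}"
  proof
    fix p
    assume "p \<in> h ` ?E"
    then obtain m where m: "p = h m" "m \<in> invariant_exponents a b d" "m \<noteq> expo 0 d 0" "m \<noteq> expo 0 0 d"
      by blast
    define i j k where ijk: "i = Poly_Mapping.lookup m 0" "j = Poly_Mapping.lookup m 1"
      "k = Poly_Mapping.lookup m 2"
    have sum: "i + j + k = d"
      using m(2) by (simp add: ijk invariant_exponents_def mdeg_ternary)
    have "j \<noteq> d"
    proof
      assume "j = d"
      then have "m = expo 0 d 0"
        using sum by (intro ternary_expo_eqI) (simp_all flip: ijk)
      then show False using m(3) by simp
    qed
    moreover have "k \<noteq> d"
    proof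
      assume "k = d"
      then have "m = expo 0 0 d"
        using sum by (intro ternary_expo_eqI) (simp_all flip: ijk)
      then show False using m(4) by simp
    qed
    moreover have "d dvd a * j + b * k"
      using m(2) by (simp add: ijk invariant_exponents_def weighted_degree_def)
    moreover have "(j, k) \<noteq> (b, d - a)"
      using sum assms by auto
    ultimately show "p \<in> H - {(b, d - a)}"
      using sum m(1) by (simp add: H_def h_def flip: ijk)
  qed
  then have "card (h ` ?E) \<le> card (H - {(b, d - a)})"
    using finH by (intro card_mono) auto
  \<comment> \<open>At most d solutions, less the excluded one; the two corners y^d and z^d raise
    the total to d + 1.\<close>
  also have "\<dots> \<le> d - 1"
    using card_weight_solutions[OF assms(4)] mem finH assms by (simp add: H_def)
  finally have "card ?E \<le> d - 1" .
  moreover have "card (invariant_exponents a b d) \<le> card (?E \<union> {expo 0 d 0, expo 0 0 d})"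
    using finite_invariant_exponents by (intro card_mono) auto
  moreover have "\<dots> \<le> card ?E + card {expo 0 d 0, expo 0 0 d}"
    by (rule card_Un_le)
  moreover have "card {expo 0 d 0, expo 0 0 d} \<le> 2"
    by (simp add: card_insert_if)
  ultimately show ?thesis
    using assms by simp
qed

lemma Var_power_mem_invariant:
  assumes "primitive_root_of_unity d e" "d > 0"
  shows "Var i ^ d \<in> invariant_monomials e a b d"
proof -
  have "Poly_Mapping.single i d \<in> invariant_exponents a b d"
    by (simp add: invariant_exponents_def weighted_degree_def lookup_single when_def)
  then show ?thesis
    by (simp add: invariant_monomials_eq[OF assms] Var_power)
qed

lemma mem_span_monomials:
  assumes "Poly_Mapping.keys f \<subseteq> A"
  shows "(f :: ('i, 'k::field) mpoly) \<in> kspace.span (monomial ` A)"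
proof -
  have "(\<Sum>m\<in>Poly_Mapping.keys f. Const (Poly_Mapping.lookup f m) * monomial m)
      \<in> kspace.span (monomial ` A)"
    using assms by (intro kspace.span_sum kspace.span_scale kspace.span_base) auto
  then show ?thesis
    by (simp only: poly_eq_sum_monomials[symmetric])
qed

text \<open>The product of the conjugates of L under the cyclic group is invariant.\<close>

lemma linear_form_multiple_in_ideal:
  fixes e :: "'k::field"
  assumes e: "primitive_root_of_unity (Suc k) e" and L: "L \<in> forms 1"
  obtains F where "F \<in> forms k" "F \<noteq> 0" "L * F \<in> ideal_gen (invariant_monomials e a b (Suc k))"
proof (cases "L = 0")
  case True
  \<comment> \<open>\<open>forms 1\<close> contains 0, and for L = 0 any nonzero form of degree k
    serves as F.\<close>
  have "L * Var 0 ^ k \<in> ideal_gen (invariant_monomials e a b (Suc k))"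
    using True ideal_0[OF is_ideal_ideal_gen] by simp
  moreover have "(Var 0 :: 'k ternary) ^ k \<in> forms k"
    by (simp add: Var_power)
  moreover have "(Var 0 :: 'k ternary) ^ k \<noteq> 0"
    unfolding Var_power by (metis keys_monomial keys_zero insert_not_empty)
  ultimately show ?thesis
    using that by blast
next
  case False
  define f where "f i = M_action (e ^ i) a b L" for i
  \<comment> \<open>The factor for i = 0 is L itself; F collects the k remaining conjugates.\<close>
  define F where "F = (\<Prod>i<k. f (Suc i))"
  have f_forms: "f i \<in> forms 1" for i
    unfolding f_def by (rule M_action_forms[OF L])
  have F: "F \<in> forms k"
    unfolding F_def using forms_prod[of "{..<k}" "\<lambda>i. f (Suc i)" "\<lambda>_. 1"] f_forms by simp
  have "f i \<noteq> 0" for i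
    using False primitive_root_nonzero[OF e] by (simp add: f_def M_action_eq_0_iff)
  then have "F \<noteq> 0"
    by (simp add: F_def)
  have f0: "f 0 = L"
    by (simp add: f_def M_action_1)
  have prod: "(\<Prod>i<Suc k. f i) = L * F"
    by (simp only: prod.lessThan_Suc_shift f0 F_def)
  \<comment> \<open>Since e has order \<open>Suc k\<close>, applying the action shifts the k + 1
    factors cyclically.\<close>
  have "f (Suc k) = f 0"
    using e by (simp only: f_def primitive_root_of_unity_def power_0)
  then have "(\<Prod>i<Suc k. f (Suc i)) = L * F"
    by (simp only: prod.lessThan_Suc f0 F_def mult.commute)
  moreover have "M_action e a b (\<Prod>i<Suc k. f i) = (\<Prod>i<Suc k. f (Suc i))"
    unfolding M_action_prod by (simp only: f_def M_action_M_action power_Suc)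
  ultimately have "M_action e a b (L * F) = L * F"
    by (simp only: prod)
  then have "Poly_Mapping.keys (L * F) \<subseteq> invariant_exponents a b (Suc k)"
    using keys_M_action_invariant[OF e] forms_mult[OF L F]
    by (auto simp: invariant_exponents_def forms_def)
  then have "L * F \<in> kspace.span (invariant_monomials e a b (Suc k))"
    by (simp add: invariant_monomials_eq[OF e] mem_span_monomials)
  then show ?thesis
    using that F \<open>F \<noteq> 0\<close> span_subset_ideal_gen by blast
qed

lemma invariant_monomials_forms: "invariant_monomials e a b d \<subseteq> forms d"
  by (auto simp: invariant_monomials_def)

lemma togliatti_system_invariant_monomials:
  fixes e :: "'k::field"
  assumes e: "primitive_root_of_unity d e" and ab: "1 \<le> a" "a < b" "b < d"
    and gcd: "gcd a (gcd b d) = 1"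
  shows "togliatti_system d (ideal_gen (invariant_monomials e a b d))"
proof -
  define S where "S = invariant_monomials e a b d"
  obtain k where d: "d = Suc k"
    using ab by (cases d) auto
  have "d > 0" using d by simp
  have S: "S \<subseteq> forms d" "finite S" "card S \<le> d + 1"
  proof -
    show "S \<subseteq> forms d"
      unfolding S_def by (rule invariant_monomials_forms)
    have "S = monomial ` invariant_exponents a b d"
      unfolding S_def by (rule invariant_monomials_eq[OF e \<open>d > 0\<close>])
    then show "finite S" "card S \<le> d + 1"
      using finite_invariant_exponents card_image_le[OF finite_invariant_exponents]
        card_invariant_exponents[OF ab gcd] order.trans by blast+
  qed
  have "Var i ^ d \<in> ideal_gen S" for i
    using Var_power_mem_invariant[OF e \<open>d > 0\<close>] kspace.span_base span_subset_ideal_gen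
    unfolding S_def by blast
  then have "artinian_ideal (ideal_gen S)"
    unfolding d by (intro artinian_idealI is_ideal_ideal_gen)
  moreover have "\<not> times_max_rank (ideal_gen S) L k" if L: "L \<in> forms 1" for L
  proof -
    obtain F where "F \<in> forms k" "F \<noteq> 0" "L * F \<in> ideal_gen S"
      using linear_form_multiple_in_ideal[OF e[unfolded d] L] unfolding S_def d by blast
    then show ?thesis
      using S L unfolding d by (intro not_times_max_rankI) auto
  qed
  ultimately show ?thesis
    using S unfolding togliatti_system_def fails_WLP_in_degree_def S_def[symmetric]
    unfolding d by auto
qed

section \<open>The action on the plane\<close>

lemma coords_nonzero: "\<exists>i. coords p i \<noteq> 0"
  using Quotient3_rep_reflp[OF Quotient3_proj, of p] by (auto simp: proportional_def)

lemma point_coords [simp]: "point (coords p) = p"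
  by (rule Quotient3_abs_rep[OF Quotient3_proj])

lemma proportional_refl: "v i \<noteq> 0 \<Longrightarrow> proportional v v"
  unfolding proportional_def by (auto intro: exI[of _ 1])

text \<open>\<open>coords\<close> picks an arbitrary representative, so coordinates come back only
  up to a nonzero scalar. The index i witnesses that v is not the zero vector, for which
  \<open>point\<close> is unspecified.\<close>

lemma coords_point:
  assumes "v i \<noteq> 0"
  obtains c where "c \<noteq> 0" "coords (point v) = (\<lambda>i. c * v i)"
proof -
  have "proportional v (coords (point v))"
    using Quotient3_rel_abs[OF Quotient3_proj] Quotient3_rel[OF Quotient3_proj, of v "coords (point v)"]
      proportional_refl[of v i, OF assms] Quotient3_rep_reflp[OF Quotient3_proj, of "point v"] by simp
  then show ?thesis
    using that by (auto simp: proportional_def)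
qed

lemma point_scale:
  assumes "c \<noteq> 0" "v i \<noteq> 0"
  shows "point (\<lambda>i. c * v i) = point v"
proof -
  have "proportional v (\<lambda>i. c * v i)"
    using assms by (auto simp: proportional_def)
  then show ?thesis
    using Quotient3_rel_abs[OF Quotient3_proj] by metis
qed

lemma point_eqD:
  assumes "point v = point w" "v i \<noteq> 0" "w j \<noteq> 0"
  obtains c where "c \<noteq> 0" "w = (\<lambda>i. c * v i)"
proof -
  have "proportional v w"
    using Quotient3_rel[OF Quotient3_proj, of v w] assms proportional_refl by metis
  then show ?thesis
    using that by (auto simp: proportional_def)
qed

lemma peval_coords_point_eq_0_iff:
  assumes "f \<in> forms k" "v i \<noteq> 0"
  shows "peval (coords (point v)) f = 0 \<longleftrightarrow> peval v f = 0"
proof -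
  obtain c where "c \<noteq> 0" "coords (point v) = (\<lambda>i. c * v i)"
    using coords_point[of v i] assms(2) by blast
  then show ?thesis
    by (simp add: peval_forms_scale[OF assms(1)])
qed

text \<open>The relation is linear in the form, so it passes from a spanning set to the span. It is
  used with c = 0 for common zeros, c = 1 for invariance and general c for equal images.\<close>

lemma peval_span_scale:
  assumes "\<And>f. f \<in> S \<Longrightarrow> peval w f = c * peval v f" "g \<in> kspace.span S"
  shows "peval w g = c * peval v (g :: ('i, 'k::field) mpoly)"
proof -
  have "kspace.subspace {f :: ('i, 'k) mpoly. peval w f = c * peval v f}"
    by (rule kspace.subspaceI) (auto simp: algebra_simps)
  then have "kspace.span S \<subseteq> {f. peval w f = c * peval v f}"
    using assms(1) by (intro kspace.span_minimal) auto
  then show ?thesis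
    using assms(2) by blast
qed

lemma weighted_degree_add: "weighted_degree a b (m + n) = weighted_degree a b m + weighted_degree a b n"
  by (simp add: weighted_degree_def lookup_add distrib_left)

lemma weighted_degree_single: "weighted_degree a b (Poly_Mapping.single i n) = weight a b i * n"
  using exhaust_ternary[of i] by (auto simp: weighted_degree_def lookup_single when_def)

text \<open>The strict a < b combines \<open>a \<le> b\<close> and \<open>a \<noteq> b\<close> of
  the theorem.\<close>

locale cyclic_diagonal_action =
  fixes e :: "'k :: {alg_closed_field, field_char_0}" and d a b :: nat
  assumes primitive_root: "primitive_root_of_unity d e"
    and weights: "1 \<le> a" "a < b" "b < d" and gcd_1: "gcd a (gcd b d) = 1"
begin

lemma d_pos: "d > 0"
  using weights by simp

lemmas e_power_eq_1_iff = primitive_root_power_eq_1_iff[OF primitive_root d_pos]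
lemmas e_power_eq_iff = primitive_root_power_eq_iff[OF primitive_root d_pos]
lemmas e_nonzero = primitive_root_nonzero[OF primitive_root d_pos]

abbreviation S :: "'k ternary set"
  where "S \<equiv> invariant_monomials e a b d"

lemmas S_eq = invariant_monomials_eq[OF primitive_root d_pos, of a b]

text \<open>The diagonal entries of the t-th power of the matrix M.\<close>

definition rot :: "nat \<Rightarrow> 3 \<Rightarrow> 'k"
  where "rot t i = (e ^ t) ^ weight a b i"

definition act :: "nat \<Rightarrow> 'k plane \<Rightarrow> 'k plane"
  where "act t p = point (\<lambda>i. rot t i * coords p i)"

lemma rot_nonzero [simp]: "rot t i \<noteq> 0"
  by (simp add: rot_def e_nonzero)

lemma rot_add: "rot (s + t) i = rot s i * rot t i"
  by (simp add: rot_def power_add power_mult_distrib)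

lemma rot_eq_1: "d dvd t \<Longrightarrow> rot t i = 1"
  using e_power_eq_1_iff[of t] by (simp add: rot_def)

lemma rot_nonzero_vector: "\<exists>i. rot t i * coords p i \<noteq> 0"
  using coords_nonzero[of p] by simp

text \<open>Shows that \<open>act\<close> is independent of the representative chosen by
  \<open>coords\<close>: a scalar commutes with the diagonal matrix.\<close>

lemma act_point:
  assumes "v i \<noteq> 0"
  shows "act t (point v) = point (\<lambda>i. rot t i * v i)"
proof -
  obtain c where c: "c \<noteq> 0" "coords (point v) = (\<lambda>i. c * v i)"
    using coords_point[of v i] assms by blast
  have "act t (point v) = point (\<lambda>i. c * (rot t i * v i))"
    by (simp add: act_def c(2) mult.left_commute)
  also have "\<dots> = point (\<lambda>i. rot t i * v i)"
    using c(1) assms by (intro point_scale[of _ _ i]) auto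
  finally show ?thesis .
qed

lemma act_act: "act s (act t p) = act (s + t) p"
proof -
  obtain i where "rot t i * coords p i \<noteq> 0"
    using rot_nonzero_vector by blast
  then have "act s (act t p) = point (\<lambda>i. rot s i * (rot t i * coords p i))"
    unfolding act_def[of t] by (rule act_point)
  then show ?thesis
    by (simp add: act_def rot_add mult.assoc)
qed

lemma act_id: "d dvd t \<Longrightarrow> act t p = p"
  by (simp add: act_def rot_eq_1)

lemma act_mod: "act (t mod d) p = act t p"
proof -
  have "act t p = act (t mod d + d * (t div d)) p"
    by simp
  also have "\<dots> = act (t mod d) (act (d * (t div d)) p)"
    by (simp only: act_act)
  finally show ?thesis
    by (simp add: act_id)
qed

lemma regular_map_act: "regular_map (act t)"
  unfolding regular_map_def
proof (intro allI exI conjI impI)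
  fix p q :: "'k plane" and j
  let ?F = "\<lambda>j. Const (rot t j) * Var j :: 'k ternary"
  show "?F j \<in> forms 1"
    by (intro forms_Const_mult forms_Var)
  show "peval (coords p) (?F (SOME i. coords p i \<noteq> 0)) \<noteq> 0"
    using someI_ex[OF coords_nonzero[of p]] by simp
  show "act t q = point (\<lambda>j. peval (coords q) (?F j))"
    by (simp add: act_def)
qed

text \<open>Exponents are natural numbers, so \<open>(d - 1) * t\<close> plays the role of -t modulo
  d.\<close>

lemma act_inverse: "act t (act ((d - 1) * t) p) = p" "act ((d - 1) * t) (act t p) = p"
proof -
  have "t + (d - 1) * t = d * t"
    using d_pos by (cases d) auto
  then show "act t (act ((d - 1) * t) p) = p" "act ((d - 1) * t) (act t p) = p"
    by (simp_all add: act_act act_id add.commute)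
qed

lemma automorphism_act: "automorphism (act t)"
proof -
  have bij: "bij (act t)"
    by (rule o_bij[of "act ((d - 1) * t)"]) (rule ext, simp only: o_apply id_apply act_inverse)+
  moreover have "inv_into UNIV (act t) = act ((d - 1) * t)"
    by (rule inv_unique_comp) (rule ext, simp only: o_apply id_apply act_inverse)+
  ultimately show ?thesis
    unfolding automorphism_def by (simp add: regular_map_act)
qed

text \<open>Freeness off the coordinate lines. As x has weight 0, the first coordinate forces the
  scalar c to be 1; the others give that d divides (t - s) a and (t - s) b, and Bezout
  finishes.\<close>

lemma act_eqD:
  assumes "act s p = act t p" "coords p 0 \<noteq> 0" "coords p 1 \<noteq> 0" "coords p 2 \<noteq> 0"
  shows "s mod d = t mod d"
proof -
  obtain c where c: "c \<noteq> 0" "(\<lambda>i. rot t i * coords p i) = (\<lambda>i. c * (rot s i * coords p i))"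
    using assms(1) unfolding act_def by (rule point_eqD[of _ _ 0 0]) (use assms(2) in auto)
  have eq: "rot t i * coords p i = c * (rot s i * coords p i)" for i
    using c(2) by (rule fun_cong)
  have "c = 1"
    using eq[of 0] assms(2) by (simp add: rot_def)
  then have "e ^ (t * a) = e ^ (s * a)" "e ^ (t * b) = e ^ (s * b)"
    using eq[of 1] eq[of 2] assms by (simp_all add: rot_def power_mult)
  then have "(t * a) mod d = (s * a) mod d" "(t * b) mod d = (s * b) mod d"
    by (simp_all only: e_power_eq_iff)
  then have ab: "int d dvd (int t - int s) * int a" "int d dvd (int t - int s) * int b"
    by (simp_all only: left_diff_distrib mod_eq_dvd_iff[symmetric] of_nat_mult[symmetric]
        zmod_int[symmetric])
  obtain u v w where uvw: "u * int a + v * int b + w * int d = 1"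
    using bezout_three[OF gcd_1] .
  have "int t - int s = (int t - int s) * (u * int a + v * int b + w * int d)"
    by (simp add: uvw)
  also have "\<dots> = u * ((int t - int s) * int a) + v * ((int t - int s) * int b)
      + int d * ((int t - int s) * w)"
    by (simp add: algebra_simps)
  finally have "int d dvd int t - int s"
    using ab by (metis dvd_add dvd_mult dvd_triv_left)
  then have "int t mod int d = int s mod int d"
    by (simp add: mod_eq_dvd_iff)
  then show ?thesis
    by (simp flip: zmod_int)
qed

lemma peval_rot:
  assumes "F \<in> kspace.span S"
  shows "peval (\<lambda>i. rot t i * v i) F = peval v F"
proof -
  have "peval (\<lambda>i. rot t i * v i) f = 1 * peval v f" if f: "f \<in> S" for f
  proof -
    obtain m where m: "f = monomial m" "d dvd weighted_degree a b m"
      using f by (auto simp: S_eq invariant_exponents_def)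
    have "(e ^ t) ^ weighted_degree a b m = 1"
      using m(2) by (simp add: e_power_eq_1_iff flip: power_mult)
    then show ?thesis
      using monomial_value_weight[of "e ^ t" a b m] by (simp add: m(1) monomial_value_mult rot_def)
  qed
  from peval_span_scale[OF this assms] show ?thesis
    by simp
qed

end

section \<open>Fibres\<close>

text \<open>h is the additive order of c modulo d. The residues annihilated by h form the only
  subgroup of order h in Z/d, and c generates it.\<close>

lemma dvd_pair_difference:
  fixes c D :: int and d h :: nat
  assumes h: "h = d div nat (gcd c (int d))" and "d > 0" and dvd: "int d dvd D * int h"
  obtains t where "int d dvd D - t * c"
proof -
  define g where "g = gcd c (int d)"
  have "g > 0" "g dvd int d"
    using assms(2) by (simp_all add: g_def)
  have "int h = int d div g"
    using \<open>g > 0\<close> by (simp add: h g_def zdiv_int)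
  then have d: "int d = g * int h"
    using \<open>g dvd int d\<close> by simp
  have "h > 0"
    using d assms(2) by (cases h) auto
  then have "g dvd D"
    using dvd by (simp add: d)
  then obtain z where z: "D = g * z" ..
  obtain x y where "x * c + y * int d = g"
    using bezout_int[of c "int d"] by (auto simp: g_def)
  then have "D - (x * z) * c = int d * (y * z)"
    unfolding z by (simp add: algebra_simps flip: \<open>x * c + y * int d = g\<close>)
  then show ?thesis
    by (intro that[of "x * z"]) simp
qed

context cyclic_diagonal_action
begin

text \<open>If v = (e^(n_i) u_i) and u agree on all invariant monomials, then n is congruent to s + t w,
  with w the weights of the action, on the support of u. With full support this follows from the
  monomial x^(b-a) y^(d-b) z^a; if the support has two elements, from an invariant monomial in these
  two variables.\<close>

lemma exponents_pair:
  assumes "i \<noteq> k" "u i \<noteq> 0" "u k \<noteq> 0"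
    and eq: "\<And>m. m \<in> invariant_exponents a b d \<Longrightarrow>
      monomial_value (\<lambda>i. e ^ n i * u i) m = monomial_value u m"
  obtains s t :: int where "int d dvd int (n i) - (s + t * int (weight a b i))"
    "int d dvd int (n k) - (s + t * int (weight a b k))"
proof -
  define c where "c = int (weight a b k) - int (weight a b i)"
  \<comment> \<open>h is the order modulo d of the weight difference c. Hence x_i^(d-h) x_k^h, whose
    weighted degree is d times the weight of i plus c h, is invariant.\<close>
  define h where "h = d div nat (gcd c (int d))"
  have "h \<le> d"
    by (simp add: h_def)
  have g: "int (nat (gcd c (int d))) = gcd c (int d)" by simp
  have "nat (gcd c (int d)) dvd d"
    by (simp add: nat_dvd_iff)
  then have "d = nat (gcd c (int d)) * h"
    by (simp add: h_def)
  then have "int d = gcd c (int d) * int h"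
    using g by (metis of_nat_mult)
  then have ch: "int d dvd c * int h"
    by (metis gcd_dvd1 mult_dvd_mono dvd_refl)
  obtain r where d: "d = h + r"
    using \<open>h \<le> d\<close> le_Suc_ex by blast
  define m where "m = Poly_Mapping.single i r + Poly_Mapping.single k h"
  have "int (weighted_degree a b m) = int (weight a b i) * int d + c * int h"
    by (simp add: m_def weighted_degree_add weighted_degree_single d c_def algebra_simps)
  then have "int d dvd int (weighted_degree a b m)"
    using ch by simp
  then have "d dvd weighted_degree a b m"
    by (simp only: of_nat_dvd_iff)
  moreover have "mdeg m = d"
    by (simp add: m_def mdeg_add d)
  ultimately have "m \<in> invariant_exponents a b d"
    by (simp add: invariant_exponents_def)
  then have "monomial_value (\<lambda>i. e ^ n i) m * monomial_value u m = monomial_value u m"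
    using eq by (simp add: monomial_value_mult)
  moreover have "monomial_value u m \<noteq> 0"
    using assms by (simp add: m_def monomial_value_add)
  ultimately have "monomial_value (\<lambda>i. e ^ n i) m = 1"
    by simp
  then have "e ^ (n i * r + n k * h) = 1"
    by (simp add: m_def monomial_value_add power_add power_mult)
  then have "int d dvd int (n i * r + n k * h)"
    by (simp only: e_power_eq_1_iff of_nat_dvd_iff)
  moreover have "int (n i * r + n k * h) = int (n i) * int d + (int (n k) - int (n i)) * int h"
    by (simp add: d algebra_simps)
  ultimately have "int d dvd (int (n k) - int (n i)) * int h"
    by (simp add: dvd_add_right_iff)
  \<comment> \<open>The value at m shows that h annihilates n k - n i modulo d, which makes this
    difference a multiple of c. The number s below then settles the congruence at i.\<close>
  then obtain t where t: "int d dvd (int (n k) - int (n i)) - t * c"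
    using dvd_pair_difference[OF h_def d_pos] by blast
  define s where "s = int (n i) - t * int (weight a b i)"
  have "int (n k) - (s + t * int (weight a b k)) = (int (n k) - int (n i)) - t * c"
    by (simp add: s_def c_def algebra_simps)
  then have "int d dvd int (n k) - (s + t * int (weight a b k))"
    using t by (simp only:)
  then show ?thesis
    by (intro that[of s t]) (simp_all add: s_def)
qed

lemma exponents_full:
  assumes "\<And>i. u i \<noteq> 0"
    and eq: "\<And>m. m \<in> invariant_exponents a b d \<Longrightarrow>
      monomial_value (\<lambda>i. e ^ n i * u i) m = monomial_value u m"
  obtains s t :: int where "\<And>i. int d dvd int (n i) - (s + t * int (weight a b i))"
proof -
  obtain p where b: "b = a + p"
    using weights le_Suc_ex less_imp_le by blast
  obtain r where d: "d = b + r"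
    using weights le_Suc_ex less_imp_le by blast
  define m where "m = expo p r a"
  have "int (weighted_degree a b m) = int d * int a"
    by (simp add: m_def weighted_degree_def d algebra_simps)
  then have "int d dvd int (weighted_degree a b m)"
    by simp
  then have "d dvd weighted_degree a b m"
    by (simp only: of_nat_dvd_iff)
  moreover have "mdeg m = d"
    by (simp add: m_def d b)
  ultimately have "m \<in> invariant_exponents a b d"
    by (simp add: invariant_exponents_def)
  then have "monomial_value (\<lambda>i. e ^ n i) m * monomial_value u m = monomial_value u m"
    using eq by (simp add: monomial_value_mult)
  moreover have "monomial_value u m \<noteq> 0"
    using assms by (simp add: monomial_value_ternary)
  ultimately have "monomial_value (\<lambda>i. e ^ n i) m = 1"
    by simp
  then have "e ^ (n 0 * p + n 1 * r + n 2 * a) = 1"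
    by (simp add: m_def monomial_value_ternary power_add power_mult)
  then have "int d dvd int (n 0 * p + n 1 * r + n 2 * a)"
    by (simp only: e_power_eq_1_iff of_nat_dvd_iff)
  \<comment> \<open>Adding a constant to all exponents n does not change the value at m, since m has
    degree d; so only the differences to n 0 matter.\<close>
  define x y where "x = int (n 1) - int (n 0)" and "y = int (n 2) - int (n 0)"
  have "int (n 0 * p + n 1 * r + n 2 * a) = int d * int (n 1) + (int a * y - int b * x)"
    by (simp add: d b algebra_simps x_def y_def)
  then have dvd: "int d dvd int a * y - int b * x"
    using \<open>int d dvd int (n 0 * p + n 1 * r + n 2 * a)\<close> by (simp add: dvd_add_right_iff)
  obtain u v w where uvw: "u * int a + v * int b + w * int d = 1"
    using bezout_three[OF gcd_1] .
  \<comment> \<open>From a y = b x modulo d, the pair (x, y) is a multiple of (a, b) modulo d; the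
    Bezout coefficients produce the multiplier.\<close>
  define t where "t = u * x + v * y"
  have "x - t * int a = x * (1 - (u * int a + v * int b + w * int d))
      + int d * (w * x) - v * (int a * y - int b * x)"
    by (simp add: t_def algebra_simps)
  then have 1: "int d dvd x - t * int a"
    using dvd by (simp add: uvw)
  have "y - t * int b = y * (1 - (u * int a + v * int b + w * int d))
      + int d * (w * y) + u * (int a * y - int b * x)"
    by (simp add: t_def algebra_simps)
  then have 2: "int d dvd y - t * int b"
    using dvd by (simp add: uvw)
  have "int d dvd int (n i) - (int (n 0) + t * int (weight a b i))" for i
    using exhaust_ternary[of i] 1 2 by (auto simp: x_def y_def algebra_simps)
  then show ?thesis
    by (rule that)
qed

lemma exponents_congruent:
  assumes eq: "\<And>m. m \<in> invariant_exponents a b d \<Longrightarrow>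
      monomial_value (\<lambda>i. e ^ n i * u i) m = monomial_value u m"
  obtains s t :: int where "\<And>i. u i \<noteq> 0 \<Longrightarrow> int d dvd int (n i) - (s + t * int (weight a b i))"
proof -
  have pair: "\<exists>s t. \<forall>l. u l \<noteq> 0 \<longrightarrow> int d dvd int (n l) - (s + t * int (weight a b l))"
    if ik: "i \<noteq> k" "\<And>l. l = i \<or> l = k \<or> u l = 0" for i k
  proof (cases "u i \<noteq> 0 \<and> u k \<noteq> 0")
    case True
    then show ?thesis
      using exponents_pair[of i k u n] ik eq by metis
  next
    case False
    \<comment> \<open>At most one coordinate is nonzero, and the scalar s = n j with t = 0 adjusts
      it.\<close>
    then obtain j where "\<And>l. u l \<noteq> 0 \<Longrightarrow> l = j"
      using ik(2) by metis
    then have "u l \<noteq> 0 \<longrightarrow> int d dvd int (n l) - (int (n j) + 0 * int (weight a b l))" for l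
      by auto
    then show ?thesis
      by blast
  qed
  have "\<exists>s t. \<forall>l. u l \<noteq> 0 \<longrightarrow> int d dvd int (n l) - (s + t * int (weight a b l))"
  proof (cases "\<forall>i. u i \<noteq> 0")
    case True
    then show ?thesis
      using exponents_full[of u n] eq by metis
  next
    case False
    then obtain i where "u i = 0" by blast
    then consider "u 0 = 0" | "u 1 = 0" | "u 2 = 0"
      using exhaust_ternary[of i] by auto
    then show ?thesis
      using pair[of 1 2] pair[of 0 2] pair[of 0 1] exhaust_ternary by cases (metis ternary_distinct(2,4))+
  qed
  then show ?thesis
    using that by blast
qed

text \<open>After rescaling, p and q agree on the invariant monomials. The pure powers then show
  that coordinates differ by powers of e, and \<open>exponents_congruent\<close> splits the
  exponents into a common scalar, invisible in the plane, and an element of the group.\<close>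

lemma fibre_act:
  fixes p q :: "'k plane"
  assumes "c \<noteq> 0" and eq: "\<And>f. f \<in> S \<Longrightarrow> peval (coords q) f = c * peval (coords p) f"
  obtains t where "q = act t p"
proof -
  define u where "u = coords p"
  \<comment> \<open>The forms in S have degree d, so dividing the coordinates of q by a d-th root of
    c absorbs the factor c.\<close>
  obtain r where r: "r ^ d = c"
    using nth_root_exists[of d c] d_pos by auto
  have "r \<noteq> 0"
    using r assms(1) d_pos by (auto simp: power_0_left)
  define v where "v i = coords q i / r" for i
  have coords_q: "coords q = (\<lambda>i. r * v i)"
    using \<open>r \<noteq> 0\<close> by (simp add: v_def)
  have v: "monomial_value v m = monomial_value u m" if "m \<in> invariant_exponents a b d" for m
  proof -
    have "monomial m \<in> S"
      using that by (simp add: S_eq)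
    then have "r ^ mdeg m * monomial_value v m = c * monomial_value u m"
      using eq[of "monomial m"] by (simp add: coords_q monomial_value_scale u_def)
    then show ?thesis
      using that assms(1) by (simp add: invariant_exponents_def r)
  qed
  have "\<exists>n. v i = e ^ n * u i" for i
  proof -
    have "Poly_Mapping.single i d \<in> invariant_exponents a b d"
      by (simp add: invariant_exponents_def weighted_degree_single)
    then have pow: "v i ^ d = u i ^ d"
      using v by fastforce
    show ?thesis
    proof (cases "u i = 0")
      case True
      then show ?thesis
        using pow d_pos by (simp add: power_0_left)
    next
      case False
      then have "(v i / u i) ^ d = 1"
        using pow by (simp add: power_divide)
      then obtain n where "v i / u i = e ^ n"
        by (rule root_of_unity_power_of_primitive[OF primitive_root d_pos])
      then show ?thesis
        using False by (auto simp: field_simps)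
    qed
  qed
  then obtain n where n: "\<And>i. v i = e ^ n i * u i"
    by metis
  then have v_eq: "v = (\<lambda>i. e ^ n i * u i)" by blast
  obtain s t :: int where st: "\<And>i. u i \<noteq> 0 \<Longrightarrow> int d dvd int (n i) - (s + t * int (weight a b i))"
    using exponents_congruent[of n u] v unfolding v_eq by metis
  \<comment> \<open>\<open>act\<close> takes a natural number, so s and t are replaced by
    nonnegative residues modulo d, which leaves the powers of e unchanged.\<close>
  define s' t' where "s' = nat (s mod int d)" and "t' = nat (t mod int d)"
  have s't': "int s' = s mod int d" "int t' = t mod int d"
    using d_pos by (simp_all add: s'_def t'_def)
  have "v i = e ^ s' * (rot t' i * u i)" for i
  proof (cases "u i = 0")
    case False
    have "int (n i) mod int d = (s + t * int (weight a b i)) mod int d"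
      using st[OF False] by (simp add: mod_eq_dvd_iff)
    also have "\<dots> = (s mod int d + (t mod int d) * int (weight a b i)) mod int d"
      by (intro mod_add_cong mod_mult_cong) simp_all
    also have "\<dots> = int (s' + t' * weight a b i) mod int d"
      by (simp add: s't')
    finally have "n i mod d = (s' + t' * weight a b i) mod d"
      by (simp only: zmod_int[symmetric] of_nat_eq_iff)
    then have "e ^ n i = e ^ (s' + t' * weight a b i)"
      by (simp only: e_power_eq_iff)
    then show ?thesis
      by (simp add: n rot_def power_add power_mult)
  qed (simp add: n)
  then have "coords q = (\<lambda>i. (r * e ^ s') * (rot t' i * coords p i))"
    by (simp add: coords_q u_def mult.assoc)
  then have "q = point (\<lambda>i. (r * e ^ s') * (rot t' i * coords p i))"
    using point_coords[of q] by simp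
  also obtain i where "rot t' i * coords p i \<noteq> 0"
    using rot_nonzero_vector by blast
  then have "point (\<lambda>i. (r * e ^ s') * (rot t' i * coords p i)) = point (\<lambda>i. rot t' i * coords p i)"
    using \<open>r \<noteq> 0\<close> e_nonzero by (intro point_scale[of _ _ i]) auto
  finally show ?thesis
    by (intro that[of t']) (simp add: act_def)
qed

end

section \<open>Finiteness\<close>

lemma image_chart_ring_Const: "(\<lambda>_. c) \<in> image_chart_ring Fs i"
  unfolding image_chart_ring_def by (rule CollectI, rule exI[of _ "Const c"]) simp

lemma image_chart_ring_add:
  assumes "x \<in> image_chart_ring Fs i" "y \<in> image_chart_ring Fs i"
  shows "(\<lambda>p. x p + y p) \<in> image_chart_ring Fs i"
proof -
  let ?r = "\<lambda>p j. if j < length Fs then peval (coords p) (Fs ! j) / peval (coords p) (Fs ! i) else 0"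
  obtain f g where "x = (\<lambda>p. peval (?r p) f)" "y = (\<lambda>p. peval (?r p) g)"
    using assms by (auto simp: image_chart_ring_def)
  then have "(\<lambda>p. x p + y p) = (\<lambda>p. peval (?r p) (f + g))" by simp
  then show ?thesis
    unfolding image_chart_ring_def by blast
qed

lemma image_chart_ring_mult:
  assumes "x \<in> image_chart_ring Fs i" "y \<in> image_chart_ring Fs i"
  shows "(\<lambda>p. x p * y p) \<in> image_chart_ring Fs i"
proof -
  let ?r = "\<lambda>p j. if j < length Fs then peval (coords p) (Fs ! j) / peval (coords p) (Fs ! i) else 0"
  obtain f g where "x = (\<lambda>p. peval (?r p) f)" "y = (\<lambda>p. peval (?r p) g)"
    using assms by (auto simp: image_chart_ring_def)
  then have "(\<lambda>p. x p * y p) = (\<lambda>p. peval (?r p) (f * g))" by simp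
  then show ?thesis
    unfolding image_chart_ring_def by blast
qed

lemma image_chart_ring_power:
  "x \<in> image_chart_ring Fs i \<Longrightarrow> (\<lambda>p. x p ^ n) \<in> image_chart_ring Fs i"
  by (induction n) (simp_all add: image_chart_ring_Const image_chart_ring_mult)

lemma image_chart_ring_prod:
  "(\<And>j. j \<in> A \<Longrightarrow> x j \<in> image_chart_ring Fs i) \<Longrightarrow> (\<lambda>p. \<Prod>j\<in>A. x j p) \<in> image_chart_ring Fs i"
  by (induction A rule: infinite_finite_induct)
    (simp_all add: image_chart_ring_Const image_chart_ring_mult)

text \<open>By linearity the chart ring contains x_j^d / F even when x_j^d is not itself one of the
  chosen generators.\<close>

lemma image_chart_ring_ratio:
  assumes "f \<in> kspace.span (set Fs)"
  shows "(\<lambda>p. peval (coords p) f / peval (coords p) (Fs ! i)) \<in> image_chart_ring Fs i"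
proof -
  let ?A = "{f. (\<lambda>p. peval (coords p) f / peval (coords p) (Fs ! i)) \<in> image_chart_ring Fs i}"
  have "kspace.subspace ?A"
  proof (rule kspace.subspaceI)
    show "0 \<in> ?A"
      by (simp add: image_chart_ring_Const)
    show "f + g \<in> ?A" if "f \<in> ?A" "g \<in> ?A" for f g
      using that image_chart_ring_add by (fastforce simp: add_divide_distrib)
    show "Const c * f \<in> ?A" if "f \<in> ?A" for c f
      using image_chart_ring_mult[OF image_chart_ring_Const[of c]] that by fastforce
  qed
  moreover have "set Fs \<subseteq> ?A"
  proof
    fix f
    assume "f \<in> set Fs"
    then obtain j where "j < length Fs" "f = Fs ! j"
      by (auto simp: in_set_conv_nth)
    then show "f \<in> ?A"
      unfolding image_chart_ring_def by (auto intro: exI[of _ "Var j"])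
  qed
  ultimately show ?thesis
    using kspace.span_minimal[of "set Fs" ?A] assms by blast
qed

text \<open>Over the ring of the chart, the quotients of a monomial with all exponents at most d by a
  power of the form F = Fs ! i generate: dividing exponents by d, every other quotient becomes such
  a quotient times a product of ratios x_j^d / F.\<close>

lemma finite_onto_imageI:
  fixes Fs :: "('i::finite, 'k::field) mpoly list"
  assumes "d > 0" "set Fs \<subseteq> forms d" and span: "\<And>j. Var j ^ d \<in> kspace.span (set Fs)"
  shows "finite_onto_image d Fs"
  unfolding finite_onto_image_def
proof (intro allI impI)
  fix i
  assume "i < length Fs"
  define F where "F p = peval (coords p) (Fs ! i)" for p
  \<comment> \<open>Divisibility of the degree by d lets a power of F cancel it, so that the
    quotient is a function on the principal open set.\<close>
  define B where "B = {r :: 'i \<Rightarrow>\<^sub>0 nat. (\<forall>j. Poly_Mapping.lookup r j \<le> d) \<and> d dvd mdeg r}"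
  define basis where "basis r p = monomial_value (coords p) r / F p ^ (mdeg r div d)" for r p
  define G where "G = basis ` B"
  define good where "good g \<longleftrightarrow> (\<exists>c. (\<forall>h\<in>G. c h \<in> image_chart_ring Fs i) \<and>
        (\<forall>p\<in>principal_open (Fs ! i). g p = (\<Sum>h\<in>G. c h p * h p)))" for g
  have "finite G"
    unfolding G_def B_def
    by (rule finite_imageI, rule finite_subset[OF _ finite_bounded_exponents[of d]]) auto
  moreover have "G \<subseteq> principal_ring d (Fs ! i)"
  proof
    fix g
    assume "g \<in> G"
    then obtain r where r: "r \<in> B" "g = basis r"
      by (auto simp: G_def)
    have "g = (\<lambda>p. peval (coords p) (monomial r) / peval (coords p) (Fs ! i) ^ (mdeg r div d))"
      by (simp add: r(2) basis_def F_def fun_eq_iff)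
    moreover have "monomial r \<in> forms (mdeg r div d * d)"
      using r(1) by (simp add: B_def)
    ultimately show "g \<in> principal_ring d (Fs ! i)"
      unfolding principal_ring_def by blast
  qed
  moreover have "good g" if g: "g \<in> principal_ring d (Fs ! i)" for g
  proof -
    have good_0: "good (\<lambda>_. 0)"
      unfolding good_def by (rule exI[of _ "\<lambda>_ _. 0"]) (simp add: image_chart_ring_Const)
    have good_add: "good (\<lambda>p. x p + y p)" if "good x" "good y" for x y
    proof -
      obtain c c' where "\<forall>h\<in>G. c h \<in> image_chart_ring Fs i" "\<forall>h\<in>G. c' h \<in> image_chart_ring Fs i"
        "\<forall>p\<in>principal_open (Fs ! i). x p = (\<Sum>h\<in>G. c h p * h p)"
        "\<forall>p\<in>principal_open (Fs ! i). y p = (\<Sum>h\<in>G. c' h p * h p)"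
        using \<open>good x\<close> \<open>good y\<close> unfolding good_def by blast
      then show ?thesis
        unfolding good_def
        by (intro exI[of _ "\<lambda>h p. c h p + c' h p"])
          (simp add: image_chart_ring_add distrib_right sum.distrib)
    qed
    have good_sum: "good (\<lambda>p. \<Sum>m\<in>M. x m p)" if "finite M" "\<And>m. m \<in> M \<Longrightarrow> good (x m)"
      for M :: "('i \<Rightarrow>\<^sub>0 nat) set" and x
      using that by (induction M rule: finite_induct) (simp_all add: good_0 good_add)
    have good_basis: "good y" if "x \<in> image_chart_ring Fs i" "r \<in> B"
      "\<And>p. p \<in> principal_open (Fs ! i) \<Longrightarrow> y p = x p * basis r p" for x y r
    proof -
      \<comment> \<open>Coefficients are indexed by the functions in G, not by exponents, as
        different exponents might define the same function; all of x goes to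
        \<open>basis r\<close>.\<close>
      let ?c = "\<lambda>h. if h = basis r then x else (\<lambda>_. 0)"
      have "(\<Sum>h\<in>G. ?c h p * h p) = (\<Sum>h\<in>G. if h = basis r then x p * basis r p else 0)" for p
        by (rule sum.cong) auto
      also have "\<dots> p = x p * basis r p" for p
        using that(2) \<open>finite G\<close> by (simp add: G_def)
      finally show ?thesis
        unfolding good_def using that by (intro exI[of _ ?c]) (simp add: image_chart_ring_Const)
    qed
    obtain P k where P: "P \<in> forms (k * d)" "g = (\<lambda>p. peval (coords p) P / F p ^ k)"
      using g by (auto simp: principal_ring_def F_def)
    have "good (\<lambda>p. Poly_Mapping.lookup P m * monomial_value (coords p) m / F p ^ k)"
      if m: "m \<in> Poly_Mapping.keys P" for m
    proof -
      define r where "r = Poly_Mapping.map (\<lambda>n. n mod d) m"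
      define q where "q j = Poly_Mapping.lookup m j div d" for j
      define Q where "Q = (\<Sum>j\<in>UNIV. q j)"
      have r: "Poly_Mapping.lookup r j = Poly_Mapping.lookup m j mod d" for j
        by (simp add: r_def Poly_Mapping.map.rep_eq when_def)
      have m_eq: "Poly_Mapping.lookup m j = Poly_Mapping.lookup r j + d * q j" for j
        by (simp add: r q_def)
      have "mdeg m = k * d"
        using P(1) m by (auto simp: forms_def)
      moreover have "mdeg m = mdeg r + d * Q"
        unfolding mdeg_superset[OF finite subset_UNIV] m_eq Q_def
        by (simp add: sum.distrib sum_distrib_left)
      ultimately have deg: "k * d = mdeg r + d * Q" by simp
      then have "d dvd mdeg r"
        by (metis dvd_add_left_iff dvd_triv_left dvd_triv_right)
      then have "r \<in> B"
        using assms(1) by (simp add: B_def r less_imp_le)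
      obtain l where l: "mdeg r = d * l"
        using \<open>d dvd mdeg r\<close> ..
      then have "d * k = d * (l + Q)"
        using deg by (simp add: distrib_left mult.commute)
      \<comment> \<open>F^k splits into F^l for the basis element and one factor F for each of the Q
        ratios x_j^d / F.\<close>
      then have k: "k = l + Q"
        using assms(1) by simp
      define x where "x p = Poly_Mapping.lookup P m * (\<Prod>j\<in>UNIV. (peval (coords p) (Var j ^ d) / F p) ^ q j)"
        for p
      have "x \<in> image_chart_ring Fs i"
        unfolding x_def F_def
        by (intro image_chart_ring_mult image_chart_ring_Const image_chart_ring_prod
            image_chart_ring_power image_chart_ring_ratio span)
      moreover have "Poly_Mapping.lookup P m * monomial_value (coords p) m / F p ^ k = x p * basis r p" for p
      proof -
        have "monomial_value (coords p) m = monomial_value (coords p) r * (\<Prod>j\<in>UNIV. (coords p j ^ d) ^ q j)"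
          unfolding monomial_value_superset[OF finite subset_UNIV] m_eq
          by (simp add: power_add power_mult prod.distrib)
        moreover have "(\<Prod>j\<in>UNIV. (coords p j ^ d / F p) ^ q j)
            = (\<Prod>j\<in>UNIV. (coords p j ^ d) ^ q j) / F p ^ Q"
          by (simp add: power_divide prod_dividef power_sum Q_def)
        moreover have "mdeg r div d = l"
          using l assms(1) by simp
        ultimately show ?thesis
          by (simp add: x_def basis_def k power_add mult_ac)
      qed
      ultimately show ?thesis
        using \<open>r \<in> B\<close> by (intro good_basis)
    qed
    then have "good (\<lambda>p. \<Sum>m\<in>Poly_Mapping.keys P.
        Poly_Mapping.lookup P m * monomial_value (coords p) m / F p ^ k)"
      by (intro good_sum) auto
    then show ?thesis
      by (simp add: P(2) peval_altdef sum_divide_distrib)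
  qed
  ultimately show "\<exists>G. finite G \<and> G \<subseteq> principal_ring d (Fs ! i) \<and>
      (\<forall>g\<in>principal_ring d (Fs ! i). \<exists>c. (\<forall>h\<in>G. c h \<in> image_chart_ring Fs i) \<and>
        (\<forall>p\<in>principal_open (Fs ! i). g p = (\<Sum>h\<in>G. c h p * h p)))"
    unfolding good_def by blast
qed

section \<open>Deck transformations\<close>

lemma Var_nonzero [simp]: "Var i \<noteq> 0"
  unfolding Var_def by (metis keys_monomial keys_zero insert_not_empty)

context cyclic_diagonal_action
begin

text \<open>The plane is irreducible, so a regular map which sends every point p to some act t p does so
  with the same t on a nonempty open set; two such open sets meet, which makes t global.\<close>

lemma regular_map_locally_act:
  assumes "regular_map \<sigma>" and orbit: "\<And>p. \<exists>t. \<sigma> p = act t p"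
  obtains t G k where "G \<in> forms k" "peval (coords p) G \<noteq> 0"
    "\<And>q. peval (coords q) G \<noteq> 0 \<Longrightarrow> \<sigma> q = act t q"
proof -
  obtain k and F :: "3 \<Rightarrow> 'k ternary" and j0 where F: "\<And>j. F j \<in> forms k"
    and j0: "peval (coords p) (F j0) \<noteq> 0"
    and \<sigma>: "\<And>q j. peval (coords q) (F j) \<noteq> 0 \<Longrightarrow> \<sigma> q = point (\<lambda>j. peval (coords q) (F j))"
    using assms(1) unfolding regular_map_def by metis
  \<comment> \<open>The 2x2 minors of the matrix with rows F and \<open>rot t\<close> times the
    variables. If all vanish, both rows define the same point wherever F j0 is nonzero.\<close>
  define D where "D t i j = F i * (Const (rot t j) * Var j) - F j * (Const (rot t i) * Var i)" for t i j
  have D_forms: "D t i j \<in> forms (k + 1)" for t i j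
    unfolding D_def by (intro forms_diff forms_mult F forms_Const_mult forms_Var)
  have peval_D: "peval v (D t i j)
      = peval v (F i) * (rot t j * v j) - peval v (F j) * (rot t i * v i)" for v t i j
    by (simp add: D_def)
  have "\<exists>t<d. \<forall>i j. D t i j = 0"
  proof (rule ccontr)
    assume "\<not> (\<exists>t<d. \<forall>i j. D t i j = 0)"
    then obtain i j where ij: "\<And>t. t < d \<Longrightarrow> D t (i t) (j t) \<noteq> 0"
      by metis
    \<comment> \<open>Were no t < d suitable, this finite product of nonzero polynomials would be
      nonzero at some v, yet a minor for the residue t with \<sigma> q = act t q must vanish at q.
      The factor F j0 makes F represent \<sigma> at q, and \<open>Var 0\<close> keeps v from being
      zero.\<close>
    define Q where "Q = (\<Prod>t<d. D t (i t) (j t)) * (F j0 * Var 0)"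
    have "Q \<in> forms ((\<Sum>t<d. k + 1) + (k + 1))"
      unfolding Q_def by (intro forms_mult forms_prod D_forms F forms_Var)
    moreover have "F j0 \<noteq> 0"
      using j0 by auto
    then have "Q \<noteq> 0"
      using ij by (simp add: Q_def)
    then obtain v where v: "peval v Q \<noteq> 0"
      using ternary_nonvanishing by blast
    then have "v 0 \<noteq> 0"
      by (auto simp: Q_def)
    define q where "q = point v"
    have "peval (coords q) Q \<noteq> 0"
      unfolding q_def using peval_coords_point_eq_0_iff[of Q _ v 0] calculation v \<open>v 0 \<noteq> 0\<close> by blast
    then have q: "peval (coords q) (F j0) \<noteq> 0" "\<And>t. t < d \<Longrightarrow> peval (coords q) (D t (i t) (j t)) \<noteq> 0"
      by (auto simp: Q_def)
    obtain s where s: "\<sigma> q = act s q"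
      using orbit by blast
    define t where "t = s mod d"
    have "t < d"
      using d_pos by (simp add: t_def)
    have "point (\<lambda>j. peval (coords q) (F j)) = point (\<lambda>i. rot t i * coords q i)"
      using \<sigma>[OF q(1)] s act_mod[of s q] by (simp add: act_def t_def)
    moreover obtain l where "rot t l * coords q l \<noteq> 0"
      using rot_nonzero_vector by blast
    ultimately obtain c where "(\<lambda>i. rot t i * coords q i) = (\<lambda>j. c * peval (coords q) (F j))"
      using q(1) point_eqD[of "\<lambda>j. peval (coords q) (F j)" "\<lambda>i. rot t i * coords q i" j0 l] by metis
    then have "rot t i * coords q i = c * peval (coords q) (F i)" for i
      by (rule fun_cong)
    then have "peval (coords q) (D t (i t) (j t)) = 0"
      by (simp add: peval_D)
    then show False
      using q(2) \<open>t < d\<close> by blast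
  qed
  then obtain t where t: "\<And>i j. D t i j = 0"
    by blast
  have "\<sigma> q = act t q" if q: "peval (coords q) (F j0) \<noteq> 0" for q
  proof -
    define c where "c = rot t j0 * coords q j0 / peval (coords q) (F j0)"
    have eq: "rot t j * coords q j = c * peval (coords q) (F j)" for j
      using peval_D[of "coords q" t j0 j] q by (simp add: t c_def field_simps)
    obtain l where "rot t l * coords q l \<noteq> 0"
      using rot_nonzero_vector by blast
    then have "c \<noteq> 0"
      using eq by auto
    then have "point (\<lambda>j. c * peval (coords q) (F j)) = point (\<lambda>j. peval (coords q) (F j))"
      using q by (rule point_scale)
    then show ?thesis
      using \<sigma>[OF q] by (simp add: act_def eq)
  qed
  then show ?thesis
    using that F j0 by blast
qed

lemma regular_map_act_unique:
  assumes "regular_map \<sigma>" and orbit: "\<And>p. \<exists>t. \<sigma> p = act t p"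
  obtains t where "\<sigma> = act t"
proof -
  fix p0 :: "'k plane"
  obtain t0 G0 k0 where G0: "G0 \<in> forms k0" "peval (coords p0) G0 \<noteq> 0"
    "\<And>q. peval (coords q) G0 \<noteq> 0 \<Longrightarrow> \<sigma> q = act t0 q"
    by (rule regular_map_locally_act[OF assms, of p0]) blast
  have "\<sigma> p = act t0 p" for p
  proof -
    obtain t G k where G: "G \<in> forms k" "peval (coords p) G \<noteq> 0"
      "\<And>q. peval (coords q) G \<noteq> 0 \<Longrightarrow> \<sigma> q = act t q"
      by (rule regular_map_locally_act[OF assms, of p]) blast
    \<comment> \<open>A point where Q does not vanish lies in both open sets and off the coordinate
      lines, so freeness identifies t0 and t modulo d.\<close>
    define Q where "Q = G0 * (G * (Var 0 * (Var 1 * Var 2)))"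
    have Q: "Q \<in> forms (k0 + (k + (1 + (1 + 1))))"
      unfolding Q_def by (intro forms_mult G0(1) G(1) forms_Var)
    have "G0 \<noteq> 0" "G \<noteq> 0"
      using G0(2) G(2) by auto
    then have "Q \<noteq> 0"
      by (simp add: Q_def)
    then obtain v where v: "peval v Q \<noteq> 0"
      using ternary_nonvanishing by blast
    then have "v 0 \<noteq> 0"
      by (auto simp: Q_def)
    define q where "q = point v"
    have "peval (coords q) Q \<noteq> 0"
      unfolding q_def using peval_coords_point_eq_0_iff[of Q _ v 0, OF Q \<open>v 0 \<noteq> 0\<close>] v by blast
    then have q: "peval (coords q) G0 \<noteq> 0" "peval (coords q) G \<noteq> 0" "coords q 0 \<noteq> 0"
      "coords q 1 \<noteq> 0" "coords q 2 \<noteq> 0"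
      by (auto simp: Q_def)
    have "act t0 q = act t q"
      using G0(3)[OF q(1)] G(3)[OF q(2)] by simp
    then have "t0 mod d = t mod d"
      using act_eqD q(3-5) by blast
    then show ?thesis
      using G(3)[OF G(2)] act_mod by metis
  qed
  then show ?thesis
    by (intro that[of t0] ext)
qed

end

text \<open>Only the span of Fs is prescribed, so the results hold for every choice of generators of
  degree d.\<close>

locale invariant_forms_map = cyclic_diagonal_action e d a b
  for e :: "'k :: {alg_closed_field, field_char_0}" and d a b :: nat +
  fixes Fs :: "'k ternary list"
  assumes Fs_forms: "set Fs \<subseteq> forms d" and Fs_span: "kspace.span (set Fs) = kspace.span S"
begin

lemma S_span: "f \<in> S \<Longrightarrow> f \<in> kspace.span (set Fs)"
  unfolding Fs_span by (rule kspace.span_base)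

lemma Var_power_span: "Var i ^ d \<in> kspace.span (set Fs)"
  by (rule S_span) (rule Var_power_mem_invariant[OF primitive_root d_pos])

text \<open>If all forms of Fs vanished at v, so would \<open>Var i ^ d\<close>, which lies in their
  span.\<close>

lemma peval_nonzero:
  assumes "v i \<noteq> 0"
  obtains j where "j < length Fs" "peval v (Fs ! j) \<noteq> 0"
proof -
  have "\<exists>f\<in>set Fs. peval v f \<noteq> 0"
  proof (rule ccontr)
    assume "\<not> (\<exists>f\<in>set Fs. peval v f \<noteq> 0)"
    then have "peval v f = 0 * peval v f" if "f \<in> set Fs" for f
      using that by simp
    from peval_span_scale[OF this Var_power_span[of i]] show False
      using assms by simp
  qed
  then show ?thesis
    using that by (metis in_set_conv_nth)
qed

definition image_coords :: "(3 \<Rightarrow> 'k) \<Rightarrow> nat \<Rightarrow> 'k"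
  where "image_coords v j = (if j < length Fs then peval v (Fs ! j) else 0)"

lemma induced_map_eq: "induced_map Fs p = point (image_coords (coords p))"
  by (simp add: induced_map_def image_coords_def[abs_def])

lemma image_coords_nonzero: "\<exists>j. image_coords (coords p) j \<noteq> 0"
  using coords_nonzero[of p] peval_nonzero[of "coords p"] unfolding image_coords_def by metis

lemma no_common_zero: "no_common_zero Fs"
  unfolding no_common_zero_def using coords_nonzero peval_nonzero by (metis nth_mem)

lemma regular_map_induced_map: "regular_map (induced_map Fs)"
  unfolding regular_map_def
proof (intro allI exI conjI impI)
  fix p q :: "'k plane" and j
  let ?F = "\<lambda>j. if j < length Fs then Fs ! j else 0"
  have F: "peval v (?F j) = image_coords v j" for v j
    by (simp add: image_coords_def)
  show "?F j \<in> forms d"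
    using Fs_forms by auto
  show "peval (coords p) (?F (SOME j. image_coords (coords p) j \<noteq> 0)) \<noteq> 0"
    unfolding F by (rule someI_ex[OF image_coords_nonzero])
  show "induced_map Fs q = point (\<lambda>j. peval (coords q) (?F j))"
    unfolding F induced_map_eq ..
qed

lemma induced_map_act: "induced_map Fs (act t p) = induced_map Fs p"
proof -
  obtain i where "rot t i * coords p i \<noteq> 0"
    using rot_nonzero_vector by blast
  then obtain c where c: "c \<noteq> 0" "coords (act t p) = (\<lambda>i. c * (rot t i * coords p i))"
    unfolding act_def using coords_point[of "\<lambda>i. rot t i * coords p i"] by blast
  have "peval (coords (act t p)) (Fs ! j) = c ^ d * peval (coords p) (Fs ! j)" if "j < length Fs" for j
  proof -
    have "Fs ! j \<in> forms d" "Fs ! j \<in> kspace.span S"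
      using that Fs_forms kspace.span_base[of "Fs ! j" "set Fs"] unfolding Fs_span by auto
    then show ?thesis
      unfolding c(2) by (simp add: peval_forms_scale peval_rot)
  qed
  then have "image_coords (coords (act t p)) = (\<lambda>j. c ^ d * image_coords (coords p) j)"
    by (auto simp: image_coords_def)
  moreover obtain j where "image_coords (coords p) j \<noteq> 0"
    using image_coords_nonzero by blast
  ultimately show ?thesis
    unfolding induced_map_eq using c(1) point_scale[of "c ^ d"] by simp
qed

lemma act_deck: "act t \<in> deck_transformations (induced_map Fs)"
  by (simp add: deck_transformations_def automorphism_act fun_eq_iff induced_map_act)

text \<open>Proportionality of the values extends from Fs to the monomials in S by linearity, which
  reduces the claim to \<open>fibre_act\<close>.\<close>

lemma induced_map_fibre:
  assumes "induced_map Fs p = induced_map Fs q"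
  obtains t where "q = act t p"
proof -
  obtain i j where "image_coords (coords p) i \<noteq> 0" "image_coords (coords q) j \<noteq> 0"
    using image_coords_nonzero by metis
  then obtain c where c: "c \<noteq> 0" "image_coords (coords q) = (\<lambda>j. c * image_coords (coords p) j)"
    using assms point_eqD[of "image_coords (coords p)" "image_coords (coords q)" i j]
    unfolding induced_map_eq by metis
  have "peval (coords q) f = c * peval (coords p) f" if f: "f \<in> set Fs" for f
  proof -
    obtain j where "j < length Fs" "f = Fs ! j"
      using f by (auto simp: in_set_conv_nth)
    then show ?thesis
      using fun_cong[OF c(2), of j] by (simp add: image_coords_def)
  qed
  from peval_span_scale[OF this S_span] show ?thesis
    using fibre_act[OF c(1)] that by blast
qed

lemma deck_transformation_act:
  assumes "\<sigma> \<in> deck_transformations (induced_map Fs)"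
  obtains t where "t < d" "\<sigma> = act t"
proof -
  have "induced_map Fs p = induced_map Fs (\<sigma> p)" for p
    using assms by (simp add: deck_transformations_def fun_eq_iff)
  then have "\<exists>t. \<sigma> p = act t p" for p
    using induced_map_fibre by metis
  moreover have "regular_map \<sigma>"
    using assms by (simp add: deck_transformations_def automorphism_def)
  ultimately obtain t where "\<sigma> = act t"
    using regular_map_act_unique by blast
  then have "\<sigma> = act (t mod d)"
    by (simp add: fun_eq_iff act_mod)
  then show ?thesis
    using that d_pos mod_less_divisor by blast
qed

lemma deck_group_iso: "deck_group (induced_map Fs) \<cong> integer_mod_group d"
proof -
  have "(\<lambda>x. act (nat x)) \<in> iso (integer_mod_group d) (deck_group (induced_map Fs))"
  proof (rule isoI)
    have "act (nat ((x + y) mod int d)) = act (nat x) \<circ> act (nat y)" if "0 \<le> x" "0 \<le> y" for x y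
    proof -
      have "nat ((x + y) mod int d) = (nat x + nat y) mod d"
        using that by (simp add: nat_mod_distrib nat_add_distrib)
      then show ?thesis
        by (simp add: fun_eq_iff act_mod act_act)
    qed
    then show "(\<lambda>x. act (nat x)) \<in> hom (integer_mod_group d) (deck_group (induced_map Fs))"
      using d_pos by (intro homI) (auto simp: carrier_integer_mod_group deck_group_def act_deck)
    have "inj_on (\<lambda>x. act (nat x)) {0..<int d}"
    proof (rule inj_onI)
      fix x y
      assume xy: "x \<in> {0..<int d}" "y \<in> {0..<int d}" "act (nat x) = act (nat y)"
      \<comment> \<open>The point (1 : 1 : 1) lies off the coordinate lines, where the action is
        free; \<open>coords\<close> returns some nonzero multiple of (1, 1, 1).\<close>
      obtain c where c: "c \<noteq> 0" "coords (point (\<lambda>_ :: 3. 1 :: 'k)) = (\<lambda>_. c * 1)"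
        using coords_point[of "\<lambda>_ :: 3. 1 :: 'k" 0] by auto
      have "nat x mod d = nat y mod d"
        using act_eqD[OF fun_cong[OF xy(3)], of "point (\<lambda>_. 1)"] c by simp
      then show "x = y"
        using xy(1,2) by (simp add: nat_less_iff eq_nat_nat_iff)
    qed
    moreover have "(\<lambda>x. act (nat x)) ` {0..<int d} = deck_transformations (induced_map Fs)"
    proof
      show "deck_transformations (induced_map Fs) \<subseteq> (\<lambda>x. act (nat x)) ` {0..<int d}"
      proof
        fix \<sigma>
        assume "\<sigma> \<in> deck_transformations (induced_map Fs)"
        then obtain t where "t < d" "\<sigma> = act t"
          by (rule deck_transformation_act)
        then show "\<sigma> \<in> (\<lambda>x. act (nat x)) ` {0..<int d}"
          by (intro image_eqI[of _ _ "int t"]) auto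
      qed
    qed (use act_deck in auto)
    ultimately show "bij_betw (\<lambda>x. act (nat x)) (carrier (integer_mod_group d))
        (carrier (deck_group (induced_map Fs)))"
      using d_pos by (simp add: bij_betw_def carrier_integer_mod_group deck_group_def)
  qed
  then show ?thesis
    using group.iso_sym[OF group_integer_mod_group] is_isoI by blast
qed

lemma galois_covering: "galois_covering_of_image d Fs (integer_mod_group d)"
  unfolding galois_covering_of_image_def
proof (intro conjI allI impI)
  show "finite_onto_image d Fs"
    using d_pos Fs_forms Var_power_span by (rule finite_onto_imageI)
  show "\<exists>\<sigma>\<in>deck_transformations (induced_map Fs). \<sigma> p = q"
    if "induced_map Fs p = induced_map Fs q" for p q
    using induced_map_fibre[OF that] act_deck by metis
qed (fact no_common_zero regular_map_induced_map deck_group_iso)+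

end

theorem theorem3p4:
  fixes e :: "'k :: {alg_closed_field, field_char_0}"
    and d a b :: nat
    and I :: "'k ternary set"
  assumes "d \<ge> 3"
    and "primitive_root_of_unity d e"
    and "1 \<le> a" and "a \<le> b" and "b \<le> d - 1"
    and "a \<noteq> b"
    and "gcd a (gcd b d) = 1"
    and "I = ideal_gen (invariant_monomials e a b d)"
  shows "GT_system d I"
proof -
  interpret cyclic_diagonal_action e d a b
    using assms by unfold_locales auto
  have "galois_covering_of_image d Fs (integer_mod_group d)" if Fs: "minimal_generators d I Fs" for Fs
  proof -
    have gens: "set Fs \<subseteq> forms d" "ideal_gen (set Fs) = ideal_gen S"
      using Fs assms(8) by (simp_all add: minimal_generators_def)
    \<comment> \<open>Each system lies in the degree d part of the ideal generated by the other, and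
      that part is a K-span.\<close>
    have "set Fs \<subseteq> kspace.span S"
      using ideal_gen_Int_forms[OF invariant_monomials_forms, of _ e a b d] gens
        span_subset_ideal_gen[of "set Fs"] kspace.span_base by blast
    moreover have "S \<subseteq> kspace.span (set Fs)"
      using ideal_gen_Int_forms[OF gens(1)] gens(2) invariant_monomials_forms
        span_subset_ideal_gen[of S] kspace.span_base by blast
    ultimately have "kspace.span (set Fs) = kspace.span S"
      by (simp add: kspace.span_eq)
    then interpret invariant_forms_map e d a b Fs
      using gens(1) by unfold_locales
    show ?thesis
      by (rule galois_covering)
  qed
  moreover have "togliatti_system d I"
    unfolding assms(8)
    by (rule togliatti_system_invariant_monomials[OF primitive_root weights gcd_1])
  ultimately show ?thesis
    by (simp add: GT_system_def)
qed

end
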